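(* Let $M \ge 1$ and $n \ge 1$ be integers and put $\mu = 2M+1$. Let $\mathcal{L}^n_\mu = [0,\mu)^n \cap \mathbb{Z}^n$, with a node $\lambda = (l_1,\dots,l_n)$ labelled by $\kappa_\lambda = \sum_{i=1}^n l_i\,\mu^{i-1}$. Consider the finite-dimensional irreducible representation of $\mathfrak{sp}(2n,\mathbb{C})$ with highest weight $(M,\dots,M)$, and map each of its weights $w = (m_1,\dots,m_n)$ (each satisfying $-M \le m_i \le M$) to the point $\lambda(w) = (m_1+M,\dots,m_n+M)$. Then $\lambda(w) \in \mathcal{L}^n_\mu$ for every weight $w$, the label $\kappa_{\lambda(w)}$ is always even, and $w \mapsto \lambda(w)$ is a bijection from the set of weights of this representation onto the set of nodes of $\mathcal{L}^n_\mu$ with even label; equivalently, the weights can be indexed as $w_p$, $p = 0,1,\dots,(\mu^n-1)/2$, with $w_p$ mapped to the node of label $\kappa = 2p$.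
   Context: Weights of a representation of $\mathfrak{sp}(2n,\mathbb{C})$ are written in coordinates with respect to the standard basis $e_1,\dots,e_n$ of the dual of the Cartan subalgebra, in which the roots are $\pm 2e_i$ and $\pm e_i \pm e_j$ ($i\ne j$); in these coordinates the highest weight $(M,\dots,M)$ has lowest weight $(-M,\dots,-M)$. *)

theory Defs
  imports Complex_Main "HOL-Library.FuncSet" "Jordan_Normal_Form.Matrix"
begin

definition symp_form :: "nat \<Rightarrow> complex mat" where
  "symp_form n = four_block_mat (0\<^sub>m n n) (1\<^sub>m n) (- 1\<^sub>m n) (0\<^sub>m n n)"

definition sp :: "nat \<Rightarrow> complex mat set" where
  "sp n = {X \<in> carrier_mat (2 * n) (2 * n).
     transpose_mat X * symp_form n + symp_form n * X = 0\<^sub>m (2 * n) (2 * n)}"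

definition lie_bracket :: "complex mat \<Rightarrow> complex mat \<Rightarrow> complex mat" where
  "lie_bracket X Y = X * Y - Y * X"

definition cartan :: "nat \<Rightarrow> complex mat set" where
  "cartan n = {H \<in> sp n. diagonal_mat H}"

text \<open>Elements of the Cartan subalgebra are the matrices
  \<open>diag (h\<^sub>1, \<dots>, h\<^sub>n, -h\<^sub>1, \<dots>, -h\<^sub>n)\<close>, and \<open>e\<^sub>i\<close> is the functional sending such a matrix
  to \<open>h\<^sub>i\<close>.  A functional \<open>\<Sum>i. w i * e\<^sub>i\<close> is encoded by its coordinate tuple \<open>w\<close>, a function that
  is extensional on \<open>{1..n}\<close>.  Matrix entries are indexed from 0, hence the shift.
  The coordinates are arbitrary complex numbers, so integrality of weights is not built in.\<close>

definition functional :: "nat \<Rightarrow> (nat \<Rightarrow> complex) \<Rightarrow> complex mat \<Rightarrow> complex" where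
  "functional n w H = (\<Sum>i = 1..n. w i * H $$ (i - 1, i - 1))"

definition root_space :: "nat \<Rightarrow> (nat \<Rightarrow> complex) \<Rightarrow> complex mat set" where
  "root_space n \<alpha> = {X \<in> sp n. \<forall>H \<in> cartan n. lie_bracket H X = functional n \<alpha> H \<cdot>\<^sub>m X}"

definition std_basis :: "nat \<Rightarrow> nat \<Rightarrow> nat \<Rightarrow> complex" where
  "std_basis n i = (\<lambda>k \<in> {1..n}. if k = i then 1 else 0)"

text \<open>Highest weights are taken with respect to this choice of positive system, for which the dominant
  weights are those with \<open>w 1 \<ge> \<dots> \<ge> w n \<ge> 0\<close>.\<close>

definition positive_roots :: "nat \<Rightarrow> (nat \<Rightarrow> complex) set" where
  "positive_roots n =
     {\<lambda>k \<in> {1..n}. std_basis n i k - std_basis n j k | i j. 1 \<le> i \<and> i < j \<and> j \<le> n} \<union>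
     {\<lambda>k \<in> {1..n}. std_basis n i k + std_basis n j k | i j. 1 \<le> i \<and> i < j \<and> j \<le> n} \<union>
     {\<lambda>k \<in> {1..n}. 2 * std_basis n i k | i. 1 \<le> i \<and> i \<le> n}"

text \<open>The representation space is the whole type \<open>'v\<close>, made into a complex vector space by
  \<open>scale\<close>; only the values of \<open>\<rho>\<close> on \<open>sp n\<close> matter.\<close>

locale sp_representation = finite_dimensional_vector_space scale Basis
  for scale :: "complex \<Rightarrow> 'v::ab_group_add \<Rightarrow> 'v" (infixr "*s" 75) and Basis :: "'v set" +
  fixes n :: nat and \<rho> :: "complex mat \<Rightarrow> 'v \<Rightarrow> 'v"
  assumes rho_linear: "X \<in> sp n \<Longrightarrow> Vector_Spaces.linear scale scale (\<rho> X)"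
    and rho_add: "X \<in> sp n \<Longrightarrow> Y \<in> sp n \<Longrightarrow> \<rho> (X + Y) v = \<rho> X v + \<rho> Y v"
    and rho_smult: "X \<in> sp n \<Longrightarrow> \<rho> (c \<cdot>\<^sub>m X) v = c *s \<rho> X v"
    and rho_bracket: "X \<in> sp n \<Longrightarrow> Y \<in> sp n \<Longrightarrow>
      \<rho> (lie_bracket X Y) v = \<rho> X (\<rho> Y v) - \<rho> Y (\<rho> X v)"
begin

definition invariant_subspace :: "'v set \<Rightarrow> bool" where
  "invariant_subspace U \<longleftrightarrow> subspace U \<and> (\<forall>X \<in> sp n. \<rho> X ` U \<subseteq> U)"

definition irreducible_rep :: bool where
  "irreducible_rep \<longleftrightarrow>
     (UNIV :: 'v set) \<noteq> {0} \<and> (\<forall>U. invariant_subspace U \<longrightarrow> U = {0} \<or> U = UNIV)"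

definition weight_space :: "(nat \<Rightarrow> complex) \<Rightarrow> 'v set" where
  "weight_space w = {v. \<forall>H \<in> cartan n. \<rho> H v = functional n w H *s v}"

definition weights :: "(nat \<Rightarrow> complex) set" where
  "weights = {w \<in> extensional {1..n}. \<exists>v \<in> weight_space w. v \<noteq> 0}"

definition has_highest_weight :: "(nat \<Rightarrow> complex) \<Rightarrow> bool" where
  "has_highest_weight w \<longleftrightarrow> w \<in> extensional {1..n} \<and>
     (\<exists>v \<in> weight_space w. v \<noteq> 0 \<and>
        (\<forall>\<alpha> \<in> positive_roots n. \<forall>X \<in> root_space n \<alpha>. \<rho> X v = 0))"

end

text \<open>Since weight coordinates are complex numbers, \<open>\<int>\<^sup>n\<close> is regarded as a subset of
  \<open>\<complex>\<^sup>n\<close>, and labels are (integral) complex numbers.  Divisibility on \<open>complex\<close> is trivial, so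
  evenness has to be expressed on the integers.\<close>

definition lattice_nodes :: "nat \<Rightarrow> nat \<Rightarrow> (nat \<Rightarrow> complex) set" where
  "lattice_nodes n \<mu> = {1..n} \<rightarrow>\<^sub>E of_int ` {0..<int \<mu>}"

definition label :: "nat \<Rightarrow> nat \<Rightarrow> (nat \<Rightarrow> complex) \<Rightarrow> complex" where
  "label n \<mu> l = (\<Sum>i = 1..n. l i * of_nat \<mu> ^ (i - 1))"

definition even_integer :: "complex \<Rightarrow> bool" where
  "even_integer z \<longleftrightarrow> (\<exists>k::int. even k \<and> z = of_int k)"

definition node_of_weight :: "nat \<Rightarrow> nat \<Rightarrow> (nat \<Rightarrow> complex) \<Rightarrow> nat \<Rightarrow> complex" where
  "node_of_weight n M w = (\<lambda>i \<in> {1..n}. w i + of_nat M)"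

end

theory Submission
  imports Defs
begin

text \<open>The highest weight \<open>(M, \<dots>, M)\<close> is orthogonal to all roots \<open>e\<^sub>i - e\<^sub>j\<close>, so \<open>sl\<^sub>2\<close>-theory shows that
  the highest weight vector is killed by their root vectors.  Hence the representation is spanned by
  products of root vectors of roots \<open>- e\<^sub>i - e\<^sub>j\<close> (with \<open>i = j\<close> allowed) applied to it, and each
  weight is \<open>(M - c\<^sub>1, \<dots>, M - c\<^sub>n)\<close> with natural \<open>c\<^sub>i\<close> whose sum is even; strings of the long roots
  give the lower bound \<open>- M\<close>.  Conversely, long root strings from the highest weight reach all weights with
  every \<open>c\<^sub>i\<close> even, and steps along \<open>e\<^sub>i + e\<^sub>j\<close> reach the others.  As \<open>\<mu>\<close> is odd, the parity of a label
  is that of the digit sum.\<close>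

subsection \<open>Root vectors\<close>

text \<open>The root vectors of \<open>e_j - e_i\<close> raise one coordinate while lowering
  another, so if they were needed among the lowering operators, the bound by \<open>M\<close> would
  be invisible in the spanning set. Their vanishing on the highest weight vector leaves only
  operators that lower coordinates, by two units in total each time; integrality, the upper bound
  and the parity then come out together. No Weyl group action is set up. If a weight w pairs with
  the coroot of a root \<alpha> to an integer k, then w - j \<alpha> is a weight for every natural j
  \<le> k, and for k \<ge> 0 the choice j = k is the reflection. This one fact serves both the lower
  bound, by reflecting a coordinate below \<open>- M\<close> to one above \<open>M\<close>, and the
  construction of weights. Finite dimension enters through the finiteness of the set of weights,
  which makes root vectors act nilpotently on weight vectors.\<close>

definition conj_index :: "nat \<Rightarrow> nat \<Rightarrow> nat" where
  "conj_index n a = (if a < n then a + n else a - n)"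

text \<open>Row \<open>a\<close> of \<open>symp_form n\<close> has a single nonzero entry:
  \<open>index_sign n a\<close>, in column \<open>conj_index n a\<close>.\<close>

definition index_sign :: "nat \<Rightarrow> nat \<Rightarrow> complex" where
  "index_sign n a = (if a < n then 1 else - 1)"

text \<open>Matrix indices \<open>a < 2 * n\<close> stand for the weights of the defining representation: \<open>e\<^sub>i\<close> for
  \<open>a = i - 1\<close> and \<open>- e\<^sub>i\<close> for \<open>a = n + i - 1\<close>.  With this convention every root is a difference of two
  of them, and \<open>root_vector n a b\<close> is the elementary matrix at \<open>(a, b)\<close> together with the companion
  entry that membership in \<open>sp n\<close> forces; for \<open>a = b\<close> it lies in the Cartan subalgebra.\<close>

definition root_vector :: "nat \<Rightarrow> nat \<Rightarrow> nat \<Rightarrow> complex mat" where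
  "root_vector n a b = mat (2 * n) (2 * n) (\<lambda>(p, q). of_bool (p = a \<and> q = b)
     - of_bool (b \<noteq> conj_index n a \<and> p = conj_index n b \<and> q = conj_index n a)
       * (index_sign n a * index_sign n b))"

definition index_weight :: "nat \<Rightarrow> nat \<Rightarrow> nat \<Rightarrow> complex" where
  "index_weight n a i = of_bool (a = i - 1) - of_bool (a = n + i - 1)"

definition index_root :: "nat \<Rightarrow> nat \<Rightarrow> nat \<Rightarrow> nat \<Rightarrow> complex" where
  "index_root n a b i = index_weight n a i - index_weight n b i"

lemma conj_index_less [simp]: "a < 2 * n \<Longrightarrow> conj_index n a < 2 * n"
  by (auto simp: conj_index_def)

lemma conj_index_conj_index [simp]: "a < 2 * n \<Longrightarrow> conj_index n (conj_index n a) = a"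
  by (auto simp: conj_index_def)

lemma index_sign_conj_index [simp]: "a < 2 * n \<Longrightarrow> index_sign n (conj_index n a) = - index_sign n a"
  by (auto simp: conj_index_def index_sign_def)

lemma index_sign_square [simp]:
  "index_sign n a * index_sign n a = 1" "index_sign n a * (index_sign n a * z) = z"
  by (auto simp: index_sign_def)

lemma conj_index_eq_iff: "a < 2 * n \<Longrightarrow> b < 2 * n \<Longrightarrow> conj_index n a = b \<longleftrightarrow> a = conj_index n b"
  by (auto simp: conj_index_def)

lemma conj_index_neq [simp]: "a < 2 * n \<Longrightarrow> conj_index n a \<noteq> a"
  by (auto simp: conj_index_def)

lemma bij_betw_conj_index: "bij_betw (conj_index n) {..<2 * n} {..<2 * n}"
  by (rule bij_betw_byWitness[where f' = "conj_index n"]) auto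

section \<open>The symplectic Lie algebra in terms of matrix entries\<close>

lemma mult_mat_entry:
  fixes A B :: "'a::semiring_0 mat"
  assumes "A \<in> carrier_mat N N" "B \<in> carrier_mat N N" "i < N" "j < N"
  shows "(A * B) $$ (i, j) = (\<Sum>k<N. A $$ (i, k) * B $$ (k, j))"
  using assms by (auto simp: scalar_prod_def lessThan_atLeast0 intro!: sum.cong)

lemma symp_form_carrier: "symp_form n \<in> carrier_mat (2 * n) (2 * n)"
  by (auto simp: symp_form_def mult_2)

lemma symp_form_entry:
  assumes "p < 2 * n" "q < 2 * n"
  shows "symp_form n $$ (p, q) = of_bool (q = conj_index n p) * index_sign n p"
  using assms by (auto simp: symp_form_def conj_index_def index_sign_def mult_2)

lemma sp_carrier: "X \<in> sp n \<Longrightarrow> X \<in> carrier_mat (2 * n) (2 * n)"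
  by (simp add: sp_def)

text \<open>Each row and column of the form has one nonzero entry, so every entry of the defining
  equation compares just two entries of \<open>X\<close>. In this shape the condition is a sign rule
  for the involution \<open>(a, b)\<close> to \<open>(conj_index n b, conj_index n a)\<close> on
  positions.\<close>

lemma sp_iff:
  "X \<in> sp n \<longleftrightarrow> X \<in> carrier_mat (2 * n) (2 * n) \<and>
     (\<forall>a<2 * n. \<forall>b<2 * n. X $$ (conj_index n b, conj_index n a)
        = - (index_sign n a * index_sign n b * X $$ (a, b)))"
proof (cases "X \<in> carrier_mat (2 * n) (2 * n)")
  case X: True
  have l: "(transpose_mat X * symp_form n) $$ (p, q)
      = - (index_sign n q * X $$ (conj_index n q, p))" if "p < 2 * n" "q < 2 * n" for p q
  proof -
    have "(transpose_mat X * symp_form n) $$ (p, q)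
        = (\<Sum>k<2 * n. transpose_mat X $$ (p, k) * symp_form n $$ (k, q))"
      using X that symp_form_carrier by (intro mult_mat_entry) auto
    also have "\<dots> = (\<Sum>k<2 * n. if k = conj_index n q then - (index_sign n q * X $$ (conj_index n q, p)) else 0)"
      using X that by (intro sum.cong) (auto simp: symp_form_entry conj_index_eq_iff)
    also have "\<dots> = - (index_sign n q * X $$ (conj_index n q, p))"
      using that by simp
    finally show ?thesis .
  qed
  have r: "(symp_form n * X) $$ (p, q) = index_sign n p * X $$ (conj_index n p, q)"
    if "p < 2 * n" "q < 2 * n" for p q
  proof -
    have "(symp_form n * X) $$ (p, q) = (\<Sum>k<2 * n. symp_form n $$ (p, k) * X $$ (k, q))"
      using X that symp_form_carrier by (intro mult_mat_entry) auto
    also have "\<dots> = (\<Sum>k<2 * n. if k = conj_index n p then index_sign n p * X $$ (conj_index n p, q) else 0)"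
      using X that by (intro sum.cong) (auto simp: symp_form_entry)
    also have "\<dots> = index_sign n p * X $$ (conj_index n p, q)"
      using that by simp
    finally show ?thesis .
  qed
  have "X \<in> sp n \<longleftrightarrow> (\<forall>p<2 * n. \<forall>q<2 * n.
      (transpose_mat X * symp_form n + symp_form n * X) $$ (p, q) = 0)"
  proof -
    have "transpose_mat X * symp_form n + symp_form n * X \<in> carrier_mat (2 * n) (2 * n)"
      using X symp_form_carrier[of n] by (intro add_carrier_mat mult_carrier_mat) auto
    then show ?thesis
      using X by (auto simp: sp_def simp del: index_add_mat(1) index_mult_mat(1) intro!: eq_matI)
  qed
  also have "\<dots> \<longleftrightarrow> (\<forall>p<2 * n. \<forall>q<2 * n.
      index_sign n p * X $$ (conj_index n p, q) = index_sign n q * X $$ (conj_index n q, p))"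
    using X symp_form_carrier[of n] l r
    by (simp del: index_mult_mat(1))
  also have "\<dots> \<longleftrightarrow> (\<forall>a<2 * n. \<forall>b<2 * n. X $$ (conj_index n b, conj_index n a)
        = - (index_sign n a * index_sign n b * X $$ (a, b)))" (is "?L \<longleftrightarrow> ?R")
  proof
    assume L: ?L
    show ?R
    proof (intro allI impI)
      fix a b assume *: "a < 2 * n" "b < 2 * n"
      then have "index_sign n b * X $$ (conj_index n b, conj_index n a) = - (index_sign n a * X $$ (a, b))"
        using L[rule_format, of b "conj_index n a"] by simp
      then have "index_sign n b * (index_sign n b * X $$ (conj_index n b, conj_index n a))
          = - (index_sign n b * (index_sign n a * X $$ (a, b)))" by simp
      then show "X $$ (conj_index n b, conj_index n a) = - (index_sign n a * index_sign n b * X $$ (a, b))"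
        by (simp add: mult_ac)
    qed
  next
    assume R: ?R
    show ?L
    proof (intro allI impI)
      fix p q assume *: "p < 2 * n" "q < 2 * n"
      then show "index_sign n p * X $$ (conj_index n p, q) = index_sign n q * X $$ (conj_index n q, p)"
        using R[rule_format, of "conj_index n q" p]
        by (simp add: mult.assoc mult.left_commute[of "index_sign n p"])
    qed
  qed
  finally show ?thesis using X by simp
qed (auto simp: sp_def)

lemma sp_add:
  assumes "X \<in> sp n" "Y \<in> sp n"
  shows "X + Y \<in> sp n"
  using assms assms[THEN sp_carrier, THEN carrier_matD(1)] assms[THEN sp_carrier, THEN carrier_matD(2)]
  by (simp add: sp_iff distrib_left)

lemma sp_smult:
  assumes "X \<in> sp n"
  shows "c \<cdot>\<^sub>m X \<in> sp n"
  using assms assms[THEN sp_carrier, THEN carrier_matD(1)] assms[THEN sp_carrier, THEN carrier_matD(2)]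
  by (simp add: sp_iff mult.left_commute[of c])

lemma sp_zero: "0\<^sub>m (2 * n) (2 * n) \<in> sp n"
  by (auto simp: sp_iff)

lemma lie_bracket_entry:
  assumes "X \<in> carrier_mat N N" "Y \<in> carrier_mat N N" "i < N" "j < N"
  shows "lie_bracket X Y $$ (i, j)
    = (\<Sum>k<N. X $$ (i, k) * Y $$ (k, j)) - (\<Sum>k<N. Y $$ (i, k) * X $$ (k, j))"
  using assms mult_mat_entry[OF assms] mult_mat_entry[OF assms(2,1,3,4)]
  by (simp add: lie_bracket_def del: index_mult_mat(1))

lemma lie_bracket_carrier:
  "X \<in> carrier_mat N N \<Longrightarrow> Y \<in> carrier_mat N N \<Longrightarrow> lie_bracket X Y \<in> carrier_mat N N"
  by (auto simp: lie_bracket_def)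

lemma sp_lie_bracket:
  assumes X: "X \<in> sp n" and Y: "Y \<in> sp n"
  shows "lie_bracket X Y \<in> sp n"
proof -
  note C = sp_carrier[OF X] sp_carrier[OF Y]
  \<comment> \<open>The involution on positions reverses products: the two minus signs cancel, and
    the sign of the summation index occurs squared.\<close>
  have *: "(\<Sum>k<2 * n. A $$ (conj_index n b, k) * B $$ (k, conj_index n a))
      = index_sign n a * index_sign n b * (\<Sum>k<2 * n. B $$ (a, k) * A $$ (k, b))"
    if "A \<in> sp n" "B \<in> sp n" "a < 2 * n" "b < 2 * n" for A B a b
  proof -
    have "(\<Sum>k<2 * n. A $$ (conj_index n b, k) * B $$ (k, conj_index n a))
        = (\<Sum>k<2 * n. A $$ (conj_index n b, conj_index n k) * B $$ (conj_index n k, conj_index n a))"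
      by (rule sum.reindex_bij_betw[symmetric, OF bij_betw_conj_index])
    also have "\<dots> = (\<Sum>k<2 * n. index_sign n a * index_sign n b * (B $$ (a, k) * A $$ (k, b)))"
      using that by (intro sum.cong) (auto simp: sp_iff mult_ac)
    finally show ?thesis by (simp add: sum_distrib_left)
  qed
  show ?thesis
    unfolding sp_iff[of "lie_bracket X Y"]
    using lie_bracket_carrier[OF C] *[OF X Y] *[OF Y X]
    by (simp add: lie_bracket_entry[OF C] right_diff_distrib mult.commute[of "Y $$ _"])
qed

section \<open>Root vectors span the Lie algebra\<close>

lemma index_sign_prod_square:
  "index_sign n a * index_sign n b * (index_sign n a * index_sign n b) = 1"
  "index_sign n b * index_sign n a * (index_sign n a * index_sign n b) = 1"
  by (simp_all add: index_sign_def)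

lemma index_sign_neq_0: "index_sign n a \<noteq> 0"
  by (simp add: index_sign_def)

lemma root_vector_carrier [simp]: "root_vector n a b \<in> carrier_mat (2 * n) (2 * n)"
  by (simp add: root_vector_def)

lemma root_vector_entry:
  "p < 2 * n \<Longrightarrow> q < 2 * n \<Longrightarrow> root_vector n a b $$ (p, q) = of_bool (p = a \<and> q = b)
     - of_bool (b \<noteq> conj_index n a \<and> p = conj_index n b \<and> q = conj_index n a)
       * (index_sign n a * index_sign n b)"
  by (simp add: root_vector_def)

lemma root_vector_sp:
  assumes "a < 2 * n" "b < 2 * n"
  shows "root_vector n a b \<in> sp n"
  unfolding sp_iff
proof (intro conjI allI impI)
  fix p q assume *: "p < 2 * n" "q < 2 * n"
  show "root_vector n a b $$ (conj_index n q, conj_index n p) =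
       - (index_sign n p * index_sign n q * root_vector n a b $$ (p, q))"
  proof -
    have eqs: "conj_index n q = a \<longleftrightarrow> q = conj_index n a" "conj_index n p = b \<longleftrightarrow> p = conj_index n b"
      "conj_index n q = conj_index n b \<longleftrightarrow> q = b" "conj_index n p = conj_index n a \<longleftrightarrow> p = a"
      "a = conj_index n b \<longleftrightarrow> b = conj_index n a"
      using assms * by (auto simp: conj_index_def split: if_splits)
    have l: "root_vector n a b $$ (conj_index n q, conj_index n p) = of_bool (p = conj_index n b \<and> q = conj_index n a)
        - of_bool (b \<noteq> conj_index n a \<and> p = a \<and> q = b) * (index_sign n a * index_sign n b)"
      using * by (simp add: root_vector_entry eqs conj_commute)
    show ?thesis
    \<comment> \<open>For a long root the companion position is \<open>(a, b)\<close> itself. It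
      must not be counted twice, and the sign rule holds there because the two signs are
      opposite.\<close>
    proof (cases "b = conj_index n a")
      case True
      then show ?thesis
        unfolding l root_vector_entry[OF *]
        using assms by (cases "p = a \<and> q = b") auto
    next
      case False
      then show ?thesis
        unfolding l root_vector_entry[OF *]
        using assms eqs(5) index_sign_prod_square[where n = n and a = a and b = b]
        by (cases "p = a \<and> q = b"; cases "p = conj_index n b \<and> q = conj_index n a") auto
    qed
  qed
qed simp

text \<open>Subtracting the multiple of \<open>root_vector n a b\<close> that clears position
  \<open>(a, b)\<close> also clears its companion and fills no zero entry, so the number of nonzero
  entries drops.\<close>

lemma sp_induct [consumes 1, case_names zero add]:
  assumes "X \<in> sp n"
    and zero: "P (0\<^sub>m (2 * n) (2 * n))"
    and add: "\<And>X c a b. X \<in> sp n \<Longrightarrow> a < 2 * n \<Longrightarrow> b < 2 * n \<Longrightarrow> a < n \<or> b < n \<Longrightarrow> P X \<Longrightarrow>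
       P (X + c \<cdot>\<^sub>m root_vector n a b)"
  shows "P X"
  using assms(1)
proof (induction "card {(p, q). p < 2 * n \<and> q < 2 * n \<and> X $$ (p, q) \<noteq> 0}" arbitrary: X rule: less_induct)
  case less
  define supp where "supp X = {(p, q). p < 2 * n \<and> q < 2 * n \<and> X $$ (p, q) \<noteq> 0}" for X :: "complex mat"
  have fin: "finite (supp X)" for X
    by (rule finite_subset[of _ "{..<2 * n} \<times> {..<2 * n}"]) (auto simp: supp_def)
  note X = sp_carrier[OF less.prems]
  show ?case
  proof (cases "supp X = {}")
    case True
    then have "X = 0\<^sub>m (2 * n) (2 * n)"
      using X by (intro eq_matI) (auto simp: supp_def)
    then show ?thesis using zero by simp
  next
    case False
    then obtain a' b' where ab': "a' < 2 * n" "b' < 2 * n" "X $$ (a', b') \<noteq> 0"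
      by (auto simp: supp_def)
    \<comment> \<open>The companion of a position in the lower right block lies in the upper left
      one, so that block can be avoided. Users of the rule may then conclude \<open>b < n\<close>
      from \<open>n \<le> a\<close>.\<close>
    obtain a b where ab: "a < 2 * n" "b < 2 * n" "X $$ (a, b) \<noteq> 0" "a < n \<or> b < n"
    proof (cases "a' < n \<or> b' < n")
      case False
      have "X $$ (conj_index n b', conj_index n a') \<noteq> 0"
        using less.prems ab' by (auto simp: sp_iff index_sign_def)
      moreover have "conj_index n b' < n" using ab' False by (auto simp: conj_index_def)
      ultimately show ?thesis using that[of "conj_index n b'" "conj_index n a'"] ab' by auto
    qed (use that ab' in blast)
    define c where "c = X $$ (a, b)"
    define Y where "Y = X + (- c) \<cdot>\<^sub>m root_vector n a b"
    have Y: "Y \<in> sp n"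
      unfolding Y_def by (intro sp_add less.prems sp_smult root_vector_sp ab)
    have "Y $$ (p, q) = X $$ (p, q) - c * root_vector n a b $$ (p, q)" if "p < 2 * n" "q < 2 * n" for p q
      using that carrier_matD[OF X] carrier_matD[OF root_vector_carrier[of n a b]]
      by (simp add: Y_def)
    moreover have "X $$ (conj_index n b, conj_index n a) = - (index_sign n a * index_sign n b * c)"
      using less.prems ab by (simp add: sp_iff c_def)
    ultimately have "X $$ (p, q) \<noteq> 0 \<and> (p, q) \<noteq> (a, b)"
      if "p < 2 * n" "q < 2 * n" "Y $$ (p, q) \<noteq> 0" for p q
      using that ab
      by (cases "p = a \<and> q = b"; cases "p = conj_index n b \<and> q = conj_index n a"; cases "b = conj_index n a")
         (auto simp: root_vector_entry c_def index_sign_neq_0)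
    then have "supp Y \<subseteq> supp X - {(a, b)}"
      by (auto simp: supp_def)
    moreover have "(a, b) \<in> supp X" using ab by (auto simp: supp_def)
    ultimately have "card (supp Y) < card (supp X)"
      by (intro psubset_card_mono fin) auto
    then have "P Y" using less.hyps[of Y] Y by (simp add: supp_def)
    then have "P (Y + c \<cdot>\<^sub>m root_vector n a b)" using add Y ab by simp
    also have "Y + c \<cdot>\<^sub>m root_vector n a b = X"
      using carrier_matD[OF X] carrier_matD[OF root_vector_carrier[of n a b]]
      by (intro eq_matI) (auto simp: Y_def)
    finally show ?thesis .
  qed
qed

section \<open>The Cartan subalgebra and its roots\<close>

lemma cartan_sp: "H \<in> cartan n \<Longrightarrow> H \<in> sp n"
  by (simp add: cartan_def)

lemma cartan_entry:
  "H \<in> cartan n \<Longrightarrow> p < 2 * n \<Longrightarrow> q < 2 * n \<Longrightarrow> p \<noteq> q \<Longrightarrow> H $$ (p, q) = 0"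
  by (auto simp: cartan_def sp_def diagonal_mat_def)

lemma functional_index_weight:
  assumes "H \<in> cartan n" "a < 2 * n"
  shows "functional n (index_weight n a) H = H $$ (a, a)"
proof -
  have conj: "H $$ (conj_index n a, conj_index n a) = - H $$ (a, a)"
    using assms cartan_sp[OF assms(1)] by (auto simp: sp_iff index_sign_def)
  define i where "i = (if a < n then a + 1 else a - n + 1)"
  have i: "i \<in> {1..n}" using assms by (auto simp: i_def)
  have "functional n (index_weight n a) H
      = (\<Sum>k = 1..n. if k = i then index_sign n a * H $$ (i - 1, i - 1) else 0)"
    unfolding functional_def
    by (intro sum.cong) (use assms(2) in \<open>auto simp: index_weight_def i_def index_sign_def split: if_splits\<close>)
  also have "\<dots> = H $$ (a, a)"
    using i conj by (auto simp: i_def index_sign_def conj_index_def split: if_splits)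
  finally show ?thesis .
qed

lemma functional_diff:
  "functional n (\<lambda>i. w i - w' i) H = functional n w H - functional n w' H"
  by (simp add: functional_def algebra_simps sum_subtractf)

lemma functional_add_scaled:
  "functional n (\<lambda>i. w i + c * w' i) H = functional n w H + c * functional n w' H"
  by (simp add: functional_def algebra_simps sum.distrib sum_distrib_left)

lemma functional_index_root:
  assumes "H \<in> cartan n" "a < 2 * n" "b < 2 * n"
  shows "functional n (index_root n a b) H = H $$ (a, a) - H $$ (b, b)"
  unfolding index_root_def by (simp add: functional_diff functional_index_weight assms)

lemma lie_bracket_cartan_entry:
  assumes "H \<in> cartan n" "X \<in> carrier_mat (2 * n) (2 * n)" "p < 2 * n" "q < 2 * n"
  shows "lie_bracket H X $$ (p, q) = (H $$ (p, p) - H $$ (q, q)) * X $$ (p, q)"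
proof -
  have "(\<Sum>k<2 * n. H $$ (p, k) * X $$ (k, q)) = (\<Sum>k<2 * n. if k = p then H $$ (p, p) * X $$ (p, q) else 0)"
    using assms by (intro sum.cong) (auto simp: cartan_entry)
  moreover have "(\<Sum>k<2 * n. X $$ (p, k) * H $$ (k, q)) = (\<Sum>k<2 * n. if k = q then H $$ (q, q) * X $$ (p, q) else 0)"
    using assms by (intro sum.cong) (auto simp: cartan_entry)
  ultimately show ?thesis
    using assms lie_bracket_entry[OF sp_carrier[OF cartan_sp[OF assms(1)]] assms(2-4)]
    by (simp add: algebra_simps)
qed

text \<open>Diagonal entries of \<open>H\<close> at conjugate indices are opposite, so the companion
  entry is scaled by the same difference as the entry at \<open>(a, b)\<close>.\<close>

lemma lie_bracket_cartan_root_vector: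
  assumes H: "H \<in> cartan n" and ab: "a < 2 * n" "b < 2 * n"
  shows "lie_bracket H (root_vector n a b) = functional n (index_root n a b) H \<cdot>\<^sub>m root_vector n a b"
proof -
  have conj: "H $$ (conj_index n c, conj_index n c) = - H $$ (c, c)" if "c < 2 * n" for c
    using that cartan_sp[OF H] by (auto simp: sp_iff index_sign_def)
  note C = lie_bracket_carrier[OF sp_carrier[OF cartan_sp[OF H]] root_vector_carrier]
  show ?thesis
    using ab carrier_matD[OF C] carrier_matD[OF root_vector_carrier[of n a b]]
    by (intro eq_matI)
       (cases "b = conj_index n a";
        force simp: lie_bracket_cartan_entry[OF H] functional_index_root[OF H] root_vector_entry conj)+
qed

section \<open>Brackets of opposite root vectors, and coordinates on the Cartan subalgebra\<close>

lemma lie_bracket_opposite_entry: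
  assumes "a < 2 * n" "b < 2 * n" "a \<noteq> b" "p < 2 * n" "q < 2 * n"
  shows "lie_bracket (root_vector n a b) (root_vector n b a) $$ (p, q)
    = of_bool (p = q) * (of_bool (p = a) - of_bool (p = conj_index n a)
        + of_bool (b \<noteq> conj_index n a) * (of_bool (p = conj_index n b) - of_bool (p = b)))"
proof -
  have *: "(\<Sum>k<2 * n. root_vector n a b $$ (p, k) * root_vector n b a $$ (k, q))
     = of_bool (p = q) * (of_bool (p = a) + of_bool (b \<noteq> conj_index n a) * of_bool (p = conj_index n b))"
    if ab: "a < 2 * n" "b < 2 * n" "a \<noteq> b" for a b
  proof -
    \<comment> \<open>The middle index \<open>b\<close> yields the diagonal entry at
      \<open>a\<close>, and \<open>conj_index n a\<close> yields the one at
      \<open>conj_index n b\<close>. For a long root these middle indices coincide, and the guard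
      keeps only the first contribution.\<close>
    have "(\<Sum>k<2 * n. root_vector n a b $$ (p, k) * root_vector n b a $$ (k, q))
     = (\<Sum>k<2 * n. (if k = b then of_bool (p = a) * of_bool (q = a) else 0) +
         (if k = conj_index n a then
           of_bool (b \<noteq> conj_index n a \<and> p = conj_index n b \<and> q = conj_index n b) else 0))"
      using assms ab
      by (intro sum.cong) (auto simp: root_vector_entry of_bool_def conj_index_eq_iff mult_ac)
    also have "\<dots> = of_bool (p = q) * (of_bool (p = a) + of_bool (b \<noteq> conj_index n a) * of_bool (p = conj_index n b))"
      using ab by (auto simp: sum.distrib)
    finally show ?thesis .
  qed
  have "lie_bracket (root_vector n a b) (root_vector n b a) $$ (p, q)
     = of_bool (p = q) * (of_bool (p = a) + of_bool (b \<noteq> conj_index n a) * of_bool (p = conj_index n b))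
     - of_bool (p = q) * (of_bool (p = b) + of_bool (a \<noteq> conj_index n b) * of_bool (p = conj_index n a))"
    using assms by (simp add: lie_bracket_entry[of _ "2 * n"] *)
  moreover have "a = conj_index n b \<longleftrightarrow> b = conj_index n a"
    using assms by auto
  ultimately show ?thesis
    by (cases "b = conj_index n a") (simp_all add: of_bool_def)
qed

lemma root_vector_diag_cartan:
  assumes "a < 2 * n"
  shows "root_vector n a a \<in> cartan n"
  using root_vector_sp[OF assms assms] by (auto simp: cartan_def diagonal_mat_def root_vector_def)

text \<open>The diagonal root vectors with index below \<open>n\<close> are dual to the
  \<open>e_i\<close>, so evaluating on them reads off coordinates.\<close>

lemma functional_root_vector_diag:
  assumes "i \<in> {1..n}"
  shows "functional n w (root_vector n (i - 1) (i - 1)) = w i"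
proof -
  have "root_vector n (i - 1) (i - 1) $$ (k - 1, k - 1) = of_bool (k = i)" if "k \<in> {1..n}" for k
  proof -
    have "i - 1 < n" "k - 1 < n" "k - 1 = i - 1 \<longleftrightarrow> k = i" using that assms by auto
    then show ?thesis by (simp add: root_vector_entry conj_index_def)
  qed
  then have "functional n w (root_vector n (i - 1) (i - 1)) = (\<Sum>k = 1..n. if k = i then w i else 0)"
    unfolding functional_def by (intro sum.cong) (auto simp del: One_nat_def)
  also have "\<dots> = w i" using assms by simp
  finally show ?thesis .
qed

lemma functional_restrict: "functional n (restrict w {1..n}) H = functional n w H"
  unfolding functional_def by (intro sum.cong) auto

lemma functional_separates:
  assumes "s \<in> extensional {1..n}" "t \<in> extensional {1..n}"
    and "\<And>H. H \<in> cartan n \<Longrightarrow> functional n s H = functional n t H"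
  shows "s = t"
proof (rule extensionalityI[OF assms(1,2)])
  fix i assume i: "i \<in> {1..n}"
  then have "root_vector n (i - 1) (i - 1) \<in> cartan n"
    by (intro root_vector_diag_cartan) auto
  from assms(3)[OF this] show "s i = t i" by (simp only: functional_root_vector_diag[OF i])
qed

text \<open>The coroot of \<open>index_root n a b\<close>. Since long root vectors also carry a
  single entry 1, every root takes the value 2 on its coroot without rescaling.\<close>

definition coroot_matrix :: "nat \<Rightarrow> nat \<Rightarrow> nat \<Rightarrow> complex mat" where
  "coroot_matrix n a b = lie_bracket (root_vector n a b) (root_vector n b a)"

lemma coroot_matrix_cartan:
  assumes "a < 2 * n" "b < 2 * n" "a \<noteq> b"
  shows "coroot_matrix n a b \<in> cartan n"
proof -
  have "coroot_matrix n a b \<in> sp n"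
    unfolding coroot_matrix_def by (intro sp_lie_bracket root_vector_sp assms)
  moreover from sp_carrier[OF this] have "diagonal_mat (coroot_matrix n a b)"
    using assms by (auto simp: diagonal_mat_def coroot_matrix_def lie_bracket_opposite_entry)
  ultimately show ?thesis by (simp add: cartan_def)
qed

lemma functional_coroot_matrix_root:
  assumes "a < 2 * n" "b < 2 * n" "a \<noteq> b"
  shows "functional n (index_root n a b) (coroot_matrix n a b) = 2"
  unfolding functional_index_root[OF coroot_matrix_cartan[OF assms] assms(1,2)]
  unfolding coroot_matrix_def
  using assms conj_index_neq[OF assms(1)] conj_index_neq[OF assms(2)]
    conj_index_neq[OF assms(1), symmetric] conj_index_neq[OF assms(2), symmetric]
  by (cases "b = conj_index n a") (auto simp: lie_bracket_opposite_entry eq_commute[of a])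

lemma index_root_swap: "index_root n b a i = - index_root n a b i"
  by (simp add: index_root_def)

subsection \<open>Weight spaces and root strings\<close>

context sp_representation
begin

lemma rho_vector_simps:
  assumes "X \<in> sp n"
  shows "\<rho> X (u + v) = \<rho> X u + \<rho> X v" "\<rho> X (c *s v) = c *s \<rho> X v" "\<rho> X 0 = 0"
    "\<rho> X (sum f A) = (\<Sum>a\<in>A. \<rho> X (f a))"
proof -
  interpret L: Vector_Spaces.linear scale scale "\<rho> X"
    by (rule rho_linear[OF assms])
  show "\<rho> X (u + v) = \<rho> X u + \<rho> X v" "\<rho> X (c *s v) = c *s \<rho> X v" "\<rho> X 0 = 0"
    "\<rho> X (sum f A) = (\<Sum>a\<in>A. \<rho> X (f a))"
    by (rule L.add L.scale L.zero L.sum)+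
qed

lemma rho_zero: "\<rho> (0\<^sub>m (2 * n) (2 * n)) v = 0"
proof -
  have "0 \<cdot>\<^sub>m 0\<^sub>m (2 * n) (2 * n) = (0\<^sub>m (2 * n) (2 * n) :: complex mat)"
    by (intro eq_matI) auto
  then show ?thesis using rho_smult[OF sp_zero, of 0 v] by simp
qed

lemma weight_spaceD: "x \<in> weight_space w \<Longrightarrow> H \<in> cartan n \<Longrightarrow> \<rho> H x = functional n w H *s x"
  by (simp add: weight_space_def)

lemma weight_space_restrict: "weight_space (restrict w {1..n}) = weight_space w"
  by (simp add: weight_space_def functional_restrict del: One_nat_def)

lemma subspace_weight_space: "subspace (weight_space w)"
  by (auto simp: subspace_def weight_space_def rho_vector_simps cartan_sp scale_right_distrib
      scale_left_commute)

lemma weight_spaces_independent: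
  assumes "finite S" "S \<subseteq> extensional {1..n}"
    and "\<And>s. s \<in> S \<Longrightarrow> x s \<in> weight_space s" "sum x S = 0" "s \<in> S"
  shows "x s = 0"
  using assms
proof (induction S arbitrary: x s rule: finite_induct)
  case (insert t S)
  have zero: "x r = 0" if r: "r \<in> S" for r
  proof -
    have "r \<noteq> t" using insert.hyps r by auto
    then obtain H where H: "H \<in> cartan n" "functional n r H \<noteq> functional n t H"
      using functional_separates[of r n t] insert.prems(1) r by auto
    \<comment> \<open>Applying \<open>\<rho> H\<close> minus its eigenvalue at \<open>t\<close>
      removes the component at \<open>t\<close> and keeps the others in their weight spaces; the
      factor at \<open>r\<close> is nonzero by the choice of \<open>H\<close>.\<close>
    define y where "y q = (functional n q H - functional n t H) *s x q" for q
    have "0 = \<rho> H (sum x (insert t S)) - functional n t H *s sum x (insert t S)"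
      using insert.prems(3) by (simp add: rho_vector_simps cartan_sp H)
    also have "\<dots> = sum y (insert t S)"
      unfolding rho_vector_simps[OF cartan_sp[OF H(1)]] scale_sum_right sum_subtractf[symmetric]
      using weight_spaceD[OF insert.prems(2) H(1)]
      by (intro sum.cong) (auto simp: y_def scale_left_diff_distrib)
    also have "\<dots> = sum y S" using insert.hyps by (simp add: y_def)
    finally have "sum y S = 0" by simp
    moreover have "y q \<in> weight_space q" if "q \<in> S" for q
      unfolding y_def using insert.prems(2) that by (intro subspace_scale subspace_weight_space) auto
    ultimately have "y r = 0" using insert.IH[of y r] insert.prems(1) r by auto
    then show ?thesis using H by (simp add: y_def)
  qed
  then have "sum x S = 0" by simp
  then have "x t = 0" using insert.prems(3) insert.hyps by simp
  then show ?case using zero insert.prems(4) by auto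
qed simp

text \<open>One nonzero vector chosen for each weight gives an independent set, which is finite in a
  finite-dimensional space.\<close>

lemma finite_weights: "finite weights"
proof -
  have "\<forall>w\<in>weights. \<exists>v. v \<in> weight_space w \<and> v \<noteq> 0" by (auto simp: weights_def)
  then obtain x where x: "\<And>w. w \<in> weights \<Longrightarrow> x w \<in> weight_space w" "\<And>w. w \<in> weights \<Longrightarrow> x w \<noteq> 0"
    by metis
  have ext: "weights \<subseteq> extensional {1..n}" by (auto simp: weights_def)
  have inj: "inj_on x weights"
  proof (rule inj_onI, rule ccontr)
    fix s t assume *: "s \<in> weights" "t \<in> weights" "x s = x t" "s \<noteq> t"
    define y where "y r = (if r = s then x s else - x t)" for r
    have "y s = 0"
    proof (rule weight_spaces_independent[of "{s, t}"])
      show "y r \<in> weight_space r" if "r \<in> {s, t}" for r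
        using that * x(1)[of r] subspace_neg[OF subspace_weight_space] by (auto simp: y_def)
    qed (use * ext in \<open>auto simp: y_def\<close>)
    then show False using x(2) * by (simp add: y_def)
  qed
  have "independent (x ` weights)"
  proof
    assume "dependent (x ` weights)"
    then obtain S u v where S: "finite S" "S \<subseteq> x ` weights" and sum: "(\<Sum>v\<in>S. u v *s v) = 0"
      and v: "v \<in> S" "u v \<noteq> 0"
      unfolding dependent_explicit by blast
    obtain T where T: "T \<subseteq> weights" "finite T" "S = x ` T"
      using finite_subset_image[OF S] by blast
    have "(\<Sum>t\<in>T. u (x t) *s x t) = 0"
      using sum T inj_on_subset[OF inj T(1)] by (simp add: sum.reindex)
    moreover obtain t where t: "t \<in> T" "v = x t" using v T by auto
    moreover have "u (x r) *s x r \<in> weight_space r" if "r \<in> T" for r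
      using that T x(1) by (intro subspace_scale subspace_weight_space) auto
    ultimately have "u (x t) *s x t = 0"
      using weight_spaces_independent[of T "\<lambda>t. u (x t) *s x t" t] T ext by blast
    then show False using v t T x(2) by auto
  qed
  then have "finite (x ` weights)" by (rule finiteI_independent)
  then show ?thesis using inj by (simp add: finite_image_iff)
qed

text \<open>Without the extensionality demanded by \<open>weights\<close>, so that weights can be
  written as arithmetic expressions; values outside \<open>{1..n}\<close> have no influence.\<close>

definition is_weight :: "(nat \<Rightarrow> complex) \<Rightarrow> bool" where
  "is_weight w \<longleftrightarrow> (\<exists>v \<in> weight_space w. v \<noteq> 0)"

lemma is_weight_restrict: "is_weight (restrict w {1..n}) \<longleftrightarrow> is_weight w"
  by (simp add: is_weight_def weight_space_restrict del: One_nat_def)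

lemma weights_iff: "w \<in> weights \<longleftrightarrow> w \<in> extensional {1..n} \<and> is_weight w"
  by (simp add: weights_def is_weight_def)

lemma root_vector_weight_space:
  assumes "x \<in> weight_space w" and ab: "a < 2 * n" "b < 2 * n"
  shows "\<rho> (root_vector n a b) x \<in> weight_space (\<lambda>i. w i + index_root n a b i)"
  unfolding weight_space_def
proof clarify
  fix H assume H: "H \<in> cartan n"
  note R = root_vector_sp[OF ab]
  have "\<rho> H (\<rho> (root_vector n a b) x)
      = \<rho> (root_vector n a b) (\<rho> H x) + \<rho> (lie_bracket H (root_vector n a b)) x"
    using rho_bracket[OF cartan_sp[OF H] R, of x] by simp
  also have "\<dots> = (functional n w H + functional n (index_root n a b) H) *s \<rho> (root_vector n a b) x"
    using assms H R by (simp add: weight_spaceD rho_vector_simps lie_bracket_cartan_root_vector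
        rho_smult scale_left_distrib)
  also have "functional n w H + functional n (index_root n a b) H
      = functional n (\<lambda>i. w i + index_root n a b i) H"
    using functional_add_scaled[of n w 1] by simp
  finally show "\<rho> H (\<rho> (root_vector n a b) x)
      = functional n (\<lambda>i. w i + index_root n a b i) H *s \<rho> (root_vector n a b) x" .
qed

section \<open>Root strings by \<open>sl_2\<close>-theory\<close>

lemma root_vector_power_weight_space:
  assumes "x \<in> weight_space w" and ab: "a < 2 * n" "b < 2 * n"
  shows "(\<rho> (root_vector n a b) ^^ r) x \<in> weight_space (\<lambda>i. w i + of_nat r * index_root n a b i)"
proof (induction r)
  case (Suc r)
  from root_vector_weight_space[OF this ab] show ?case
    by (simp add: algebra_simps)
qed (use assms in simp)

text \<open>Otherwise w + r \<alpha> would be a weight for every r. These are pairwise distinct,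
  because their values on the coroot grow by 2 with each step, and there are only finitely many
  weights.\<close>

lemma root_vector_nilpotent:
  assumes x: "x \<in> weight_space w" and ab: "a < 2 * n" "b < 2 * n" "a \<noteq> b"
  shows "\<exists>r. (\<rho> (root_vector n a b) ^^ r) x = 0"
proof (rule ccontr)
  assume nonzero: "\<not> ?thesis"
  define f where "f r = restrict (\<lambda>i. w i + of_nat r * index_root n a b i) {1..n}" for r :: nat
  have "f r \<in> weights" for r
    using root_vector_power_weight_space[OF x ab(1,2), of r] nonzero
    unfolding weights_iff f_def is_weight_restrict by (auto simp: is_weight_def)
  moreover have "functional n (f r) (coroot_matrix n a b)
      = functional n w (coroot_matrix n a b) + of_nat r * 2" for r
    using ab by (simp add: f_def functional_restrict functional_add_scaled functional_coroot_matrix_root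
        del: One_nat_def)
  then have "inj f"
    by (intro injI) (metis add_left_cancel mult_right_cancel of_nat_eq_iff zero_neq_numeral)
  moreover have "finite (range f)"
    using finite_weights calculation(1) by (blast intro: finite_subset)
  ultimately show False
    using finite_imageD[of f UNIV] infinite_UNIV_nat by blast
qed

text \<open>Below, \<open>root_vector n a b\<close>, \<open>root_vector n b a\<close> and \<open>coroot_matrix n a b\<close>
  play the roles of \<open>E\<close>, \<open>F\<close> and \<open>H\<close> in an \<open>sl\<^sub>2\<close>-triple.\<close>

lemma raise_lower_power:
  assumes x: "x \<in> weight_space w" "\<rho> (root_vector n a b) x = 0"
    and ab: "a < 2 * n" "b < 2 * n" "a \<noteq> b"
  shows "\<rho> (root_vector n a b) ((\<rho> (root_vector n b a) ^^ Suc j) x)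
    = (of_nat (Suc j) * (functional n w (coroot_matrix n a b) - of_nat j)) *s (\<rho> (root_vector n b a) ^^ j) x"
proof (induction j)
  case 0
  have "\<rho> (root_vector n a b) (\<rho> (root_vector n b a) x)
     = \<rho> (root_vector n b a) (\<rho> (root_vector n a b) x) + \<rho> (coroot_matrix n a b) x"
    using rho_bracket[of "root_vector n a b" "root_vector n b a" x] ab
    by (simp add: coroot_matrix_def root_vector_sp)
  then show ?case
    using x ab by (simp add: rho_vector_simps root_vector_sp weight_spaceD coroot_matrix_cartan)
next
  case (Suc j)
  define c where "c = functional n w (coroot_matrix n a b)"
  define y where "y = (\<rho> (root_vector n b a) ^^ Suc j) x"
  have "y \<in> weight_space (\<lambda>i. w i + of_nat (Suc j) * index_root n b a i)"
    unfolding y_def using x ab by (intro root_vector_power_weight_space)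
  then have "y \<in> weight_space (\<lambda>i. w i + (- of_nat (Suc j)) * index_root n a b i)"
    by (subst (asm) index_root_swap) (simp only: minus_mult_minus minus_mult_commute)
  then have "\<rho> (coroot_matrix n a b) y = (c + (- of_nat (Suc j)) * 2) *s y"
    by (simp only: weight_spaceD coroot_matrix_cartan ab functional_add_scaled
        functional_coroot_matrix_root c_def not_False_eq_True)
  moreover have "\<rho> (root_vector n a b) (\<rho> (root_vector n b a) y)
     = \<rho> (root_vector n b a) (\<rho> (root_vector n a b) y) + \<rho> (coroot_matrix n a b) y"
    using rho_bracket[of "root_vector n a b" "root_vector n b a" y] ab
    by (simp add: coroot_matrix_def root_vector_sp)
  moreover have "\<rho> (root_vector n b a) (\<rho> (root_vector n a b) y)
     = (of_nat (Suc j) * (c - of_nat j)) *s y"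
    using Suc.IH ab by (simp add: y_def c_def rho_vector_simps root_vector_sp)
  ultimately have "\<rho> (root_vector n a b) (\<rho> (root_vector n b a) y)
     = (of_nat (Suc j) * (c - of_nat j) + (c + (- of_nat (Suc j)) * 2)) *s y"
    by (simp only: scale_left_distrib)
  also have "of_nat (Suc j) * (c - of_nat j) + (c + (- of_nat (Suc j)) * 2)
     = of_nat (Suc (Suc j)) * (c - of_nat (Suc j))"
    by (simp add: algebra_simps)
  finally show ?case by (simp add: y_def c_def)
qed

text \<open>Raising the (j+1)-st lowered vector returns the j-th one times (j + 1) (c - j), where c
  is the coroot value; no power vanishes before one of these factors does. Combined with nilpotence
  this forces c to be a natural number, and for known c it produces weights.\<close>

lemma lower_power_nonzero:
  assumes x: "x \<in> weight_space w" "x \<noteq> 0" "\<rho> (root_vector n a b) x = 0"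
    and ab: "a < 2 * n" "b < 2 * n" "a \<noteq> b"
    and "\<And>i. i < j \<Longrightarrow> functional n w (coroot_matrix n a b) \<noteq> of_nat i"
  shows "(\<rho> (root_vector n b a) ^^ j) x \<noteq> 0"
  using assms(7)
proof (induction j)
  case (Suc j)
  then have "(of_nat (Suc j) * (functional n w (coroot_matrix n a b) - of_nat j)) *s
      (\<rho> (root_vector n b a) ^^ j) x \<noteq> 0"
    by (simp del: of_nat_Suc)
  then show ?case
    unfolding raise_lower_power[OF x(1,3) ab, symmetric]
    using ab by (auto simp: rho_vector_simps root_vector_sp)
qed (use x in simp)

lemma highest_functional_nat:
  assumes x: "x \<in> weight_space w" "x \<noteq> 0" "\<rho> (root_vector n a b) x = 0"
    and ab: "a < 2 * n" "b < 2 * n" "a \<noteq> b"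
  obtains K :: nat where "functional n w (coroot_matrix n a b) = of_nat K"
proof -
  obtain r where "(\<rho> (root_vector n b a) ^^ r) x = 0"
    using root_vector_nilpotent[OF x(1) ab(2,1)] ab by auto
  then show ?thesis
    using lower_power_nonzero[OF x ab, of r] that by blast
qed

text \<open>A nonzero lowered vector would again be killed by raising, since the factor c is 0, and
  so would have a natural coroot value; but that value is -2.\<close>

lemma lower_eq_0:
  assumes x: "x \<in> weight_space w" "\<rho> (root_vector n a b) x = 0"
    and ab: "a < 2 * n" "b < 2 * n" "a \<noteq> b"
    and c: "functional n w (coroot_matrix n a b) = 0"
  shows "\<rho> (root_vector n b a) x = 0"
proof (rule ccontr)
  let ?y = "\<rho> (root_vector n b a) x"
  assume "?y \<noteq> 0"
  moreover have "?y \<in> weight_space (\<lambda>i. w i + (- 1) * index_root n a b i)"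
    using root_vector_weight_space[OF x(1) ab(2,1)] by (subst (asm) index_root_swap) simp
  moreover have "\<rho> (root_vector n a b) ?y = 0"
    using raise_lower_power[OF x ab, of 0] c by simp
  ultimately obtain K :: nat where
    "functional n (\<lambda>i. w i + (- 1) * index_root n a b i) (coroot_matrix n a b) = of_nat K"
    using highest_functional_nat ab by blast
  then have "of_nat (K + 2) = (0 :: complex)"
    unfolding functional_add_scaled functional_coroot_matrix_root[OF ab] c by simp
  then show False by (simp only: of_nat_eq_0_iff)
qed

text \<open>Climb to the top w + s \<alpha> of the string, where the coroot value is k + 2 s, and
  descend j + s steps. As j + s \<le> k + 2 s, no zero factor is met.\<close>

lemma weight_string:
  assumes w: "is_weight w" and ab: "a < 2 * n" "b < 2 * n" "a \<noteq> b"
    and k: "functional n w (coroot_matrix n a b) = of_int k" "int j \<le> k"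
  shows "is_weight (\<lambda>i. w i - of_nat j * index_root n a b i)"
proof -
  obtain x where x: "x \<in> weight_space w" "x \<noteq> 0" using w by (auto simp: is_weight_def)
  define E where "E = \<rho> (root_vector n a b)"
  obtain r where "(E ^^ r) x = 0" "\<And>s. s < r \<Longrightarrow> (E ^^ s) x \<noteq> 0"
    using exists_least_iff[of "\<lambda>r. (E ^^ r) x = 0"] root_vector_nilpotent[OF x(1) ab]
    unfolding E_def by blast
  moreover from this(1) x obtain s where "r = Suc s" by (cases r) auto
  ultimately have s: "E ((E ^^ s) x) = 0" "(E ^^ s) x \<noteq> 0" by auto
  define w' where "w' = (\<lambda>i. w i + of_nat s * index_root n a b i)"
  define y where "y = (E ^^ s) x"
  have y: "y \<in> weight_space w'" "y \<noteq> 0" "\<rho> (root_vector n a b) y = 0"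
    using root_vector_power_weight_space[OF x(1) ab(1,2), of s] s by (auto simp: y_def w'_def E_def)
  have w': "functional n w' (coroot_matrix n a b) = of_int (k + 2 * int s)"
    by (simp add: w'_def functional_add_scaled functional_coroot_matrix_root ab k)
  have "(\<rho> (root_vector n b a) ^^ (j + s)) y \<noteq> 0"
  proof (rule lower_power_nonzero[OF y ab])
    fix i assume "i < j + s"
    then have "k + 2 * int s \<noteq> int i" using k(2) by linarith
    then show "functional n w' (coroot_matrix n a b) \<noteq> of_nat i"
      unfolding w' by (metis of_int_eq_iff of_int_of_nat_eq)
  qed
  moreover have "(\<rho> (root_vector n b a) ^^ (j + s)) y
      \<in> weight_space (\<lambda>i. w' i + of_nat (j + s) * index_root n b a i)"
    using y(1) ab by (intro root_vector_power_weight_space)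
  moreover have "(\<lambda>i. w' i + of_nat (j + s) * index_root n b a i) = (\<lambda>i. w i - of_nat j * index_root n a b i)"
    by (subst index_root_swap) (simp add: w'_def fun_eq_iff algebra_simps)
  ultimately show ?thesis by (auto simp: is_weight_def)
qed

end

section \<open>Roots and coroots in coordinates\<close>

lemma index_weight_simps:
  assumes "i < n" "k \<in> {1..n}"
  shows "index_weight n i k = of_bool (k = Suc i)" "index_weight n (n + i) k = - of_bool (k = Suc i)"
proof -
  have "i = k - 1 \<longleftrightarrow> k = Suc i" "n + i = n + k - 1 \<longleftrightarrow> k = Suc i" "i \<noteq> n + k - 1" "n + i \<noteq> k - 1"
    using assms by auto
  then show "index_weight n i k = of_bool (k = Suc i)" "index_weight n (n + i) k = - of_bool (k = Suc i)"
    by (simp_all only: index_weight_def) simp_all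
qed

text \<open>The standard inner product of \<open>w\<close> with the weight
  \<open>index_weight n a\<close>; the successor translates matrix indices, counted from 0, into
  coordinates, counted from 1.\<close>

definition index_coord :: "nat \<Rightarrow> (nat \<Rightarrow> complex) \<Rightarrow> nat \<Rightarrow> complex" where
  "index_coord n w a = (if a < n then w (Suc a) else - w (Suc (a - n)))"

text \<open>The plain difference would give twice the coordinate for a long root, but the coroot of
  \<open>2 e_i\<close> pairs as \<open>e_i\<close>; hence the case distinction.\<close>

lemma functional_coroot_matrix:
  assumes "a < 2 * n" "b < 2 * n" "a \<noteq> b"
  shows "functional n w (coroot_matrix n a b) = index_coord n w a
    - (if b = conj_index n a then 0 else index_coord n w b)"
proof -
  define S where "S c = (\<Sum>k = 1..n. w k * of_bool (k - 1 = c))" for c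
  have S: "S c = (if c < n then w (Suc c) else 0)" for c
  proof -
    have "S c = (\<Sum>k = 1..n. if k = Suc c then w (Suc c) else 0)"
      unfolding S_def by (intro sum.cong) auto
    then show ?thesis by simp
  qed
  have "functional n w (coroot_matrix n a b) = (\<Sum>k = 1..n. w k * of_bool (k - 1 = a) - w k * of_bool (k - 1 = conj_index n a)
     + of_bool (b \<noteq> conj_index n a) * (w k * of_bool (k - 1 = conj_index n b) - w k * of_bool (k - 1 = b)))"
    unfolding functional_def
  proof (intro sum.cong refl)
    fix k assume "k \<in> {1..n}"
    then have k: "k - 1 < 2 * n" by auto
    show "w k * coroot_matrix n a b $$ (k - 1, k - 1) = w k * of_bool (k - 1 = a) - w k * of_bool (k - 1 = conj_index n a)
     + of_bool (b \<noteq> conj_index n a) * (w k * of_bool (k - 1 = conj_index n b) - w k * of_bool (k - 1 = b))"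
      unfolding coroot_matrix_def lie_bracket_opposite_entry[OF assms k k]
      by (simp only: refl) (simp add: algebra_simps)
  qed
  also have "\<dots> = S a - S (conj_index n a) + of_bool (b \<noteq> conj_index n a) * (S (conj_index n b) - S b)"
    unfolding S_def by (simp only: sum.distrib sum_subtractf flip: sum_distrib_left)
  also have "\<dots> = index_coord n w a - (if b = conj_index n a then 0 else index_coord n w b)"
    using assms by (auto simp: S index_coord_def conj_index_def)
  finally show ?thesis .
qed

lemma root_vector_root_space:
  assumes "a < 2 * n" "b < 2 * n"
  shows "root_vector n a b \<in> root_space n (restrict (index_root n a b) {1..n})"
  using assms
  by (simp add: root_space_def root_vector_sp lie_bracket_cartan_root_vector functional_restrict
      del: One_nat_def)

lemma index_root_positive_minus:
  assumes "i < j" "j < n"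
  shows "restrict (index_root n i j) {1..n} \<in> positive_roots n"
proof -
  have "restrict (index_root n i j) {1..n} = (\<lambda>k \<in> {1..n}. std_basis n (Suc i) k - std_basis n (Suc j) k)"
    using assms by (auto simp: index_root_def index_weight_simps std_basis_def of_bool_def simp del: One_nat_def
        intro!: restrict_ext)
  moreover have "1 \<le> Suc i \<and> Suc i < Suc j \<and> Suc j \<le> n" using assms by simp
  ultimately show ?thesis unfolding positive_roots_def by blast
qed

lemma index_root_positive_plus:
  assumes "i < n" "j < n"
  shows "restrict (index_root n i (n + j)) {1..n} \<in> positive_roots n"
proof -
  have *: "restrict (index_root n i (n + j)) {1..n} = (\<lambda>k \<in> {1..n}. std_basis n (Suc i) k + std_basis n (Suc j) k)"
    using assms by (auto simp: index_root_def index_weight_simps std_basis_def of_bool_def simp del: One_nat_def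
        intro!: restrict_ext)
  consider "i < j" | "i = j" | "j < i" by linarith
  then show ?thesis
  proof cases
    case 1
    then have "1 \<le> Suc i \<and> Suc i < Suc j \<and> Suc j \<le> n" using assms by simp
    with * show ?thesis unfolding positive_roots_def by blast
  next
    case 2
    have "restrict (index_root n i (n + j)) {1..n} = (\<lambda>k \<in> {1..n}. 2 * std_basis n (Suc i) k)"
      unfolding * using 2 by simp
    moreover have "1 \<le> Suc i \<and> Suc i \<le> n" using assms by simp
    ultimately show ?thesis unfolding positive_roots_def by blast
  next
    case 3
    have "restrict (index_root n i (n + j)) {1..n} = (\<lambda>k \<in> {1..n}. std_basis n (Suc j) k + std_basis n (Suc i) k)"
      unfolding * by (simp add: add.commute)
    moreover have "1 \<le> Suc j \<and> Suc j < Suc i \<and> Suc i \<le> n" using assms 3 by simp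
    ultimately show ?thesis unfolding positive_roots_def by blast
  qed
qed

context sp_representation
begin

section \<open>Root strings in integer coordinates\<close>

lemma is_weight_cong:
  assumes "\<And>k. k \<in> {1..n} \<Longrightarrow> w k = w' k"
  shows "is_weight w \<longleftrightarrow> is_weight w'"
proof -
  have "restrict w {1..n} = restrict w' {1..n}" using assms by (rule restrict_ext)
  then show ?thesis by (metis is_weight_restrict)
qed

text \<open>This and the next three lemmas are the root strings along \<open>2 e_i\<close>,
  \<open>- 2 e_i\<close>, \<open>e_i + e_j\<close> and \<open>- e_i - e_j\<close>; the bounds are
  the pairings with the respective coroots.\<close>

lemma weight_long_lower:
  assumes "is_weight (\<lambda>k. of_int (m k))" "i < n" "int j \<le> m (Suc i)"
  shows "is_weight (\<lambda>k. of_int (m k - 2 * int j * of_bool (k = Suc i)))"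
proof -
  have "is_weight (\<lambda>k. of_int (m k) - of_nat j * index_root n i (n + i) k)"
    by (rule weight_string[where k = "m (Suc i)"])
      (use assms in \<open>auto simp: functional_coroot_matrix index_coord_def conj_index_def\<close>)
  also have "?this \<longleftrightarrow> ?thesis"
    using assms(2) by (intro is_weight_cong) (auto simp: index_root_def index_weight_simps simp del: One_nat_def)
  finally show ?thesis .
qed

lemma weight_long_raise:
  assumes "is_weight (\<lambda>k. of_int (m k))" "i < n" "int j \<le> - m (Suc i)"
  shows "is_weight (\<lambda>k. of_int (m k + 2 * int j * of_bool (k = Suc i)))"
proof -
  have "is_weight (\<lambda>k. of_int (m k) - of_nat j * index_root n (n + i) i k)"
    by (rule weight_string[where k = "- m (Suc i)"])
      (use assms in \<open>auto simp: functional_coroot_matrix index_coord_def conj_index_def\<close>)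
  also have "?this \<longleftrightarrow> ?thesis"
    using assms(2) by (intro is_weight_cong) (auto simp: index_root_def index_weight_simps simp del: One_nat_def)
  finally show ?thesis .
qed

lemma weight_short_lower:
  assumes "is_weight (\<lambda>k. of_int (m k))" "i < n" "j < n" "i \<noteq> j" "1 \<le> m (Suc i) + m (Suc j)"
  shows "is_weight (\<lambda>k. of_int (m k - of_bool (k = Suc i) - of_bool (k = Suc j)))"
proof -
  have "is_weight (\<lambda>k. of_int (m k) - of_nat 1 * index_root n i (n + j) k)"
    by (rule weight_string[where k = "m (Suc i) + m (Suc j)"])
      (use assms in \<open>auto simp: functional_coroot_matrix index_coord_def conj_index_def\<close>)
  also have "?this \<longleftrightarrow> ?thesis"
    using assms(2,3) by (intro is_weight_cong) (auto simp: index_root_def index_weight_simps simp del: One_nat_def)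
  finally show ?thesis .
qed

lemma weight_short_raise:
  assumes "is_weight (\<lambda>k. of_int (m k))" "i < n" "j < n" "i \<noteq> j" "m (Suc i) + m (Suc j) \<le> - 1"
  shows "is_weight (\<lambda>k. of_int (m k + of_bool (k = Suc i) + of_bool (k = Suc j)))"
proof -
  have "is_weight (\<lambda>k. of_int (m k) - of_nat 1 * index_root n (n + j) i k)"
    by (rule weight_string[where k = "- (m (Suc i) + m (Suc j))"])
      (use assms in \<open>auto simp: functional_coroot_matrix index_coord_def conj_index_def\<close>)
  also have "?this \<longleftrightarrow> ?thesis"
    using assms(2,3) by (intro is_weight_cong) (auto simp: index_root_def index_weight_simps simp del: One_nat_def)
  finally show ?thesis .
qed

section \<open>Upper bound and parity for the weights\<close>

lemma span_weight_spaces: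
  assumes "y \<in> span (\<Union>w\<in>P. weight_space w)"
  shows "\<exists>S x. finite S \<and> S \<subseteq> P \<and> (\<forall>s\<in>S. x s \<in> weight_space s) \<and> y = sum x S"
  using assms
proof (induction rule: span_induct_alt)
  case base
  show ?case by (rule exI[of _ "{}"]) auto
next
  case (step c z y)
  then obtain t S x where t: "t \<in> P" "z \<in> weight_space t"
    and S: "finite S" "S \<subseteq> P" "\<forall>s\<in>S. x s \<in> weight_space s" "y = sum x S" by blast
  \<comment> \<open>The new vector is merged with the component already present at \<open>t\<close>.
    Outside \<open>S\<close> the value of \<open>x\<close> is arbitrary, hence the default
    0.\<close>
  define x' where "x' = x(t := (if t \<in> S then x t else 0) + c *s z)"
  have "sum x' (insert t S) = x' t + sum x (S - {t})"
    using S(1) by (simp add: sum.insert_remove x'_def)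
  also have "sum x (S - {t}) = y - (if t \<in> S then x t else 0)"
    using S(1,4) by (simp add: sum_diff1)
  finally have "c *s z + y = sum x' (insert t S)" by (simp add: x'_def)
  moreover have "\<forall>s\<in>insert t S. x' s \<in> weight_space s"
    using S(3) t(2) subspace_add[OF subspace_weight_space] subspace_scale[OF subspace_weight_space]
      subspace_0[OF subspace_weight_space] by (auto simp: x'_def)
  ultimately show ?case using S t by (intro exI[of _ "insert t S"] exI[of _ x']) auto
qed

text \<open>A weight vector for a weight outside \<open>P\<close> would be a sum of vectors from
  other weight spaces, against their independence.\<close>

lemma weight_of_span:
  assumes P: "P \<subseteq> extensional {1..n}" and "span (\<Union>w\<in>P. weight_space w) = UNIV" and w: "w \<in> weights"
  shows "w \<in> P"
proof (rule ccontr)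
  assume "w \<notin> P"
  obtain u where u: "u \<in> weight_space w" "u \<noteq> 0" using w by (auto simp: weights_def)
  obtain S x where S: "finite S" "S \<subseteq> P" "\<forall>s\<in>S. x s \<in> weight_space s" "u = sum x S"
    using span_weight_spaces[of u P] assms(2) by blast
  define x' where "x' = x(w := - u)"
  have "x' w = 0"
  proof (rule weight_spaces_independent[of "insert w S"])
    show "sum x' (insert w S) = 0"
    proof -
      have "w \<notin> S" using S(2) \<open>w \<notin> P\<close> by blast
      then have "sum x' S = sum x S" by (intro sum.cong) (auto simp: x'_def)
      then show ?thesis using S(1,4) \<open>w \<notin> S\<close> by (simp add: x'_def)
    qed
    show "x' s \<in> weight_space s" if "s \<in> insert w S" for s
      using that S(3) u(1) subspace_neg[OF subspace_weight_space] by (auto simp: x'_def)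
  qed (use S P w in \<open>auto simp: weights_def\<close>)
  then show False using u by (simp add: x'_def)
qed

lemma highest_weight_vector:
  assumes "has_highest_weight (\<lambda>i \<in> {1..n}. of_nat M)"
  obtains v where "v \<noteq> 0" "v \<in> weight_space (\<lambda>i. of_nat M)"
    "\<And>a b. a < n \<Longrightarrow> b < 2 * n \<Longrightarrow> a \<noteq> b \<Longrightarrow> \<rho> (root_vector n a b) v = 0"
proof -
  obtain v where v: "v \<noteq> 0" "v \<in> weight_space (\<lambda>i. of_nat M)"
    and pos: "\<And>\<alpha> X. \<alpha> \<in> positive_roots n \<Longrightarrow> X \<in> root_space n \<alpha> \<Longrightarrow> \<rho> X v = 0"
    using assms unfolding has_highest_weight_def weight_space_restrict by blast
  have less: "\<rho> (root_vector n a b) v = 0" if "a < b" "b < n" for a b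
    using pos[OF index_root_positive_minus[OF that] root_vector_root_space] that by simp
  show ?thesis
  proof (rule that[OF v])
    fix a b assume ab: "a < n" "b < 2 * n" "a \<noteq> b"
    consider "b < n" "a < b" | "b < n" "b < a" | "n \<le> b" using ab by linarith
    then show "\<rho> (root_vector n a b) v = 0"
    proof cases
      case 2
      \<comment> \<open>Here the root is negative. The opposite, positive root vector kills
        \<open>v\<close>, and its coroot pairs with the highest weight to \<open>M - M\<close>, that
        is 0.\<close>
      show ?thesis
        by (rule lower_eq_0[OF v(2)])
          (use 2 ab less in \<open>auto simp: functional_coroot_matrix index_coord_def conj_index_def\<close>)
    next
      case 3
      then have "root_vector n a b \<in> root_space n (restrict (index_root n a (n + (b - n))) {1..n})"
        using root_vector_root_space[of a n b] ab by simp
      then show ?thesis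
        using pos index_root_positive_plus[of a n "b - n"] 3 ab by (metis add_less_cancel_left le_add_diff_inverse mult_2)
    qed (use less in simp)
  qed
qed

text \<open>The smallest subspace \<open>F\<close> containing \<open>v\<close> and closed under the operators \<open>Y\<close> of the roots
  \<open>- e\<^sub>i - e\<^sub>j\<close> is invariant, without any appeal to the PBW theorem: the vectors that all of \<open>sp n\<close> maps
  into \<open>F\<close> form a subspace closed under each \<open>Y\<close>, because \<open>X Y y = [X, Y] y + Y X y\<close>.\<close>

lemma lower_closed_subspace_UNIV:
  assumes irr: irreducible_rep
    and v: "v \<noteq> 0" "v \<in> weight_space w"
      "\<And>a b. a < n \<Longrightarrow> b < 2 * n \<Longrightarrow> a \<noteq> b \<Longrightarrow> \<rho> (root_vector n a b) v = 0"
    and U: "subspace U" "v \<in> U"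
      "\<And>i j y. i < n \<Longrightarrow> j < n \<Longrightarrow> y \<in> U \<Longrightarrow> \<rho> (root_vector n (n + i) j) y \<in> U"
  shows "U = UNIV"
proof -
  define closed where "closed U \<longleftrightarrow> subspace U \<and> v \<in> U \<and>
    (\<forall>i<n. \<forall>j<n. \<forall>y\<in>U. \<rho> (root_vector n (n + i) j) y \<in> U)" for U
  define F where "F = \<Inter>{U. closed U}"
  have sub: "subspace F" unfolding F_def by (rule subspace_Inter) (auto simp: closed_def)
  have F: "closed F" using sub by (auto simp: F_def closed_def)
  define G where "G = {y \<in> F. \<forall>X\<in>sp n. \<rho> X y \<in> F}"
  have "subspace G"
    unfolding subspace_def G_def
    using subspace_add[OF sub] subspace_scale[OF sub] subspace_0[OF sub] by (auto simp: rho_vector_simps)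
  moreover have "v \<in> G"
  proof -
    have "\<rho> X v \<in> F" if "X \<in> sp n" for X
      using that
    proof (induction rule: sp_induct)
      case zero
      show ?case using subspace_0[OF sub] by (simp add: rho_zero)
    next
      case (add X c a b)
      \<comment> \<open>For \<open>a < n\<close> the vector \<open>v\<close> is killed or, when
        \<open>a = b\<close>, rescaled. For \<open>n \<le> a\<close> the induction rule provides
        \<open>b < n\<close>, so this is one of the lowering operators under which \<open>F\<close>
        is closed.\<close>
      have "\<rho> (root_vector n a b) v \<in> F"
      proof (cases "a < n")
        case True
        have "\<rho> (root_vector n a a) v \<in> F"
          using weight_spaceD[OF v(2) root_vector_diag_cartan] add F subspace_scale[OF sub]
          by (auto simp: closed_def)
        then show ?thesis using v(3)[of a b] True add subspace_0[OF sub] by (cases "a = b") auto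
      next
        case False
        then obtain i where "a = n + i" "i < n" using add by (metis add_less_cancel_left le_Suc_ex mult_2 not_less)
        then show ?thesis using False add F by (auto simp: closed_def)
      qed
      then show ?case
        using add subspace_add[OF sub] subspace_scale[OF sub]
        by (simp add: rho_add rho_smult sp_smult root_vector_sp)
    qed
    then show ?thesis using F by (auto simp: G_def closed_def)
  qed
  moreover have "\<rho> (root_vector n (n + i) j) y \<in> G" if ij: "i < n" "j < n" and y: "y \<in> G" for i j y
  proof -
    let ?Y = "root_vector n (n + i) j"
    have Y: "?Y \<in> sp n" using ij by (intro root_vector_sp) auto
    have "\<rho> X (\<rho> ?Y y) \<in> F" if X: "X \<in> sp n" for X
    proof -
      have "\<rho> X (\<rho> ?Y y) = \<rho> (lie_bracket X ?Y) y + \<rho> ?Y (\<rho> X y)"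
        using rho_bracket[OF X Y, of y] by simp
      also have "\<dots> \<in> F"
        using y F ij X Y sp_lie_bracket[OF X Y] by (intro subspace_add sub) (auto simp: G_def closed_def)
      finally show ?thesis .
    qed
    then show ?thesis using y F ij by (auto simp: G_def closed_def)
  qed
  ultimately have "closed G" by (auto simp: closed_def)
  then have "F \<subseteq> G" by (auto simp: F_def)
  then have "invariant_subspace F" using sub by (auto simp: invariant_subspace_def G_def)
  moreover have "F \<noteq> {0}" using F v(1) by (auto simp: closed_def)
  ultimately have "F = UNIV" using irr by (auto simp: irreducible_rep_def)
  moreover have "closed U" using U by (auto simp: closed_def)
  ultimately show ?thesis by (auto simp: F_def)
qed

text \<open>The weight spaces for the candidates in \<open>P\<close> span a subspace that contains
  the highest weight vector and is closed under lowering, hence is everything; so no weight lies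
  outside \<open>P\<close>.\<close>

lemma weight_upper_bound:
  assumes irr: irreducible_rep and hw: "has_highest_weight (\<lambda>i \<in> {1..n}. of_nat M)"
    and w: "is_weight w"
  obtains c :: "nat \<Rightarrow> nat" where "\<And>k. k \<in> {1..n} \<Longrightarrow> w k = of_nat M - of_nat (c k)" "even (\<Sum>k = 1..n. c k)"
proof -
  define P :: "(nat \<Rightarrow> complex) set" where "P = {w \<in> extensional {1..n}. \<exists>c :: nat \<Rightarrow> nat.
    (\<forall>k \<in> {1..n}. w k = of_nat M - of_nat (c k)) \<and> even (\<Sum>k = 1..n. c k)}"
  obtain v where v: "v \<noteq> 0" "v \<in> weight_space (\<lambda>i. of_nat M)"
    "\<And>a b. a < n \<Longrightarrow> b < 2 * n \<Longrightarrow> a \<noteq> b \<Longrightarrow> \<rho> (root_vector n a b) v = 0"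
    using highest_weight_vector[OF hw] by blast
  have "span (\<Union>w\<in>P. weight_space w) = UNIV"
  proof (rule lower_closed_subspace_UNIV[OF irr v], assumption+)
    show "subspace (span (\<Union>w\<in>P. weight_space w))" by (rule subspace_span)
    have "restrict (\<lambda>i. of_nat M) {1..n} \<in> P"
      by (auto simp: P_def intro!: exI[of _ "\<lambda>_. 0"])
    moreover have "v \<in> weight_space (restrict (\<lambda>i. of_nat M) {1..n})"
      using v(2) by (simp only: weight_space_restrict)
    ultimately show "v \<in> span (\<Union>w\<in>P. weight_space w)"
      by (intro span_base) blast
  next
    fix i j y assume ij: "i < n" "j < n" and y: "y \<in> span (\<Union>w\<in>P. weight_space w)"
    let ?Y = "root_vector n (n + i) j"
    have Y: "?Y \<in> sp n" using ij by (intro root_vector_sp) auto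
    show "\<rho> ?Y y \<in> span (\<Union>w\<in>P. weight_space w)"
      using y
    proof (induction rule: span_induct_alt)
      case base
      then show ?case using Y by (simp add: rho_vector_simps span_zero)
    next
      case (step a z y)
      then obtain s where s: "s \<in> P" "z \<in> weight_space s" by blast
      then obtain c :: "nat \<Rightarrow> nat" where c: "\<And>k. k \<in> {1..n} \<Longrightarrow> s k = of_nat M - of_nat (c k)"
          "even (\<Sum>k = 1..n. c k)"
        by (auto simp: P_def)
      define t where "t = restrict (\<lambda>k. s k + index_root n (n + i) j k) {1..n}"
      have "t \<in> P"
        unfolding P_def
      proof (intro CollectI conjI exI ballI)
        \<comment> \<open>For \<open>i = j\<close> both indicators hit the same coordinate, so long
          and short roots alike raise the sum of the \<open>c k\<close> by 2.\<close>
        show "t k = of_nat M - of_nat (c k + of_bool (k = Suc i) + of_bool (k = Suc j))" if "k \<in> {1..n}" for k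
          using that ij c(1) by (simp add: t_def index_root_def index_weight_simps del: One_nat_def)
        show "even (\<Sum>k = 1..n. c k + of_bool (k = Suc i) + of_bool (k = Suc j))"
        proof -
          have "(\<Sum>k = 1..n. of_bool (k = Suc l)) = (1 :: nat)" if "l < n" for l
            using that by (simp add: of_bool_def)
          then show ?thesis using c(2) ij by (simp add: sum.distrib)
        qed
      qed (simp add: t_def)
      moreover have "\<rho> ?Y z \<in> weight_space t"
        unfolding t_def weight_space_restrict
        using s(2) ij by (intro root_vector_weight_space) auto
      ultimately have "\<rho> ?Y z \<in> span (\<Union>w\<in>P. weight_space w)"
        by (intro span_base) blast
      then show ?case using step Y by (simp add: rho_vector_simps span_add span_scale)
    qed
  qed
  moreover have "restrict w {1..n} \<in> weights"
    using w is_weight_restrict[of w] by (simp add: weights_iff del: One_nat_def)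
  ultimately have "restrict w {1..n} \<in> P"
    by (intro weight_of_span[of P]) (auto simp: P_def)
  then show ?thesis using that by (force simp: P_def simp del: One_nat_def)
qed

end

section \<open>Construction of all admissible weights, and the lower bound\<close>

context sp_representation
begin

lemma is_weight_highest:
  assumes "has_highest_weight (\<lambda>i \<in> {1..n}. of_nat M)"
  shows "is_weight (\<lambda>i. of_nat M)"
  using highest_weight_vector[OF assms] by (metis is_weight_def)

text \<open>Coordinates are adjusted one at a time. Coordinate \<open>i\<close> still equals
  \<open>M\<close> when its turn comes, so the string along \<open>2 e_i\<close> allows up to
  \<open>M\<close> steps of size 2 and reaches every value of the right parity down to
  \<open>- M\<close>.\<close>

lemma is_weight_even_coords:
  assumes hw: "has_highest_weight (\<lambda>i \<in> {1..n}. of_nat M)"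
    and "finite T" "T \<subseteq> {1..n}"
    and "\<And>k. k \<in> T \<Longrightarrow> \<bar>m k\<bar> \<le> int M \<and> even (int M - m k)"
  shows "is_weight (\<lambda>k. of_int (if k \<in> T then m k else int M))"
  using assms(2-4)
proof (induction T rule: finite_induct)
  case empty
  then show ?case using is_weight_highest[OF hw] by simp
next
  case (insert i T)
  define f where "f k = (if k \<in> T then m k else int M)" for k
  define j where "j = nat ((int M - m i) div 2)"
  have m: "\<bar>m i\<bar> \<le> int M" "even (int M - m i)" using insert.prems(2)[of i] by auto
  have i: "i - 1 < n" "Suc (i - 1) = i" using insert.prems(1) by auto
  have j: "2 * int j = int M - m i" using m by (auto simp: j_def)
  have "is_weight (\<lambda>k. of_int (f k - 2 * int j * of_bool (k = Suc (i - 1))))"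
  proof (rule weight_long_lower)
    show "is_weight (\<lambda>k. of_int (f k))"
      unfolding f_def by (rule insert.IH) (use insert.prems in auto)
    show "int j \<le> f (Suc (i - 1))" using m j i insert.hyps by (simp add: f_def)
  qed (rule i)
  also have "(\<lambda>k. f k - 2 * int j * of_bool (k = Suc (i - 1))) = (\<lambda>k. if k \<in> insert i T then m k else int M)"
    using insert.hyps unfolding i(2) j by (auto simp: f_def fun_eq_iff)
  finally show ?case .
qed

text \<open>Coordinates with \<open>M - m k\<close> odd come in even number. Shifting two of them by
  the same unit makes both differences even; the shifted tuple is a weight by induction, and a short
  root string leads back from it.\<close>

lemma is_weight_if_bounded:
  assumes hw: "has_highest_weight (\<lambda>i \<in> {1..n}. of_nat M)"
    and "\<And>k. k \<in> {1..n} \<Longrightarrow> \<bar>m k\<bar> \<le> int M" "even (\<Sum>k = 1..n. int M - m k)"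
  shows "is_weight (\<lambda>k. of_int (m k))"
  using assms(2,3)
proof (induction "card {k \<in> {1..n}. odd (int M - m k)}" arbitrary: m rule: less_induct)
  case less
  define S where "S m = {k \<in> {1..n}. odd (int M - m k)}" for m :: "nat \<Rightarrow> int"
  have fin: "finite (S m)" for m by (simp add: S_def)
  have card: "even (card (S m))" using less.prems(2) by (simp add: S_def even_sum_iff)
  show ?case
  proof (cases "S m = {}")
    case True
    then have "is_weight (\<lambda>k. of_int (if k \<in> {1..n} then m k else int M))"
      using less.prems(1) by (intro is_weight_even_coords[OF hw]) (auto simp: S_def)
    also have "?this \<longleftrightarrow> ?thesis" by (rule is_weight_cong) auto
    finally show ?thesis .
  next
    case False
    then obtain i where i: "i \<in> S m" by blast
    have "S m \<noteq> {i}" using card by auto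
    then obtain j where j: "j \<in> S m" "i \<noteq> j" using i by blast
    have ij: "i - 1 < n" "j - 1 < n" "Suc (i - 1) = i" "Suc (j - 1) = j" "i - 1 \<noteq> j - 1"
      using i j by (auto simp: S_def)
    have step: "is_weight (\<lambda>k. of_int (m k + e * (of_bool (k = i) + of_bool (k = j))))"
      if e: "\<bar>e\<bar> = 1" for e :: int
    proof -
      define m' where "m' k = m k + e * (of_bool (k = i) + of_bool (k = j))" for k
      have odd: "odd e" using e by (auto simp: abs_if split: if_splits)
      have "S m' \<subseteq> S m - {i}" using i j odd by (auto simp: S_def m'_def)
      then have "card (S m') < card (S m)" using i by (intro psubset_card_mono fin) auto
      moreover have "\<bar>m' k\<bar> \<le> int M" if k: "k \<in> {1..n}" for k
      proof (cases "k \<in> S m")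
        \<comment> \<open>Both \<open>M\<close> and \<open>- M\<close> have even difference from
          \<open>M\<close>, so an odd difference leaves room for a shift by one in either
          direction.\<close>
        case True
        then have "odd (int M - m k)" by (simp add: S_def)
        then have "m k \<noteq> int M" "m k \<noteq> - int M" by auto
        then have "\<bar>m k\<bar> + 1 \<le> int M" using less.prems(1)[OF k] by linarith
        then show ?thesis using e j(2) by (auto simp: m'_def of_bool_def)
      next
        case False
        then have "k \<noteq> i" "k \<noteq> j" using i j by auto
        then show ?thesis using less.prems(1)[OF k] by (simp add: m'_def)
      qed
      moreover have "(\<Sum>k = 1..n. int M - m' k) = (\<Sum>k = 1..n. int M - m k) - 2 * e"
      proof -
        have "(\<Sum>k = 1..n. of_bool (k = l)) = (1 :: int)" if "l \<in> S m" for l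
          using that by (simp add: of_bool_def S_def)
        then have "(\<Sum>k = 1..n. e * (of_bool (k = i) + of_bool (k = j))) = 2 * e"
          using i j by (simp add: sum.distrib flip: sum_distrib_left)
        then show ?thesis by (simp add: m'_def sum_subtractf sum.distrib)
      qed
      ultimately have "is_weight (\<lambda>k. of_int (m' k))"
        using less.hyps[of m'] less.prems(2) by (simp add: S_def)
      then show ?thesis by (simp add: m'_def)
    qed
    \<comment> \<open>The sign of \<open>e\<close> is chosen so that the shifted weight pairs with the coroot of \<open>e\<^sub>i + e\<^sub>j\<close> to a
      number of the same sign, so that the root string leads back to \<open>m\<close>.\<close>
    show ?thesis
    proof (cases "- 1 \<le> m i + m j")
      case True
      have "is_weight (\<lambda>k. of_int (m k + 1 * (of_bool (k = i) + of_bool (k = j))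
          - of_bool (k = Suc (i - 1)) - of_bool (k = Suc (j - 1))))"
        by (rule weight_short_lower[OF step ij(1,2,5)]) (use True ij j in auto)
      then show ?thesis unfolding ij by simp
    next
      case False
      have "is_weight (\<lambda>k. of_int (m k + (- 1) * (of_bool (k = i) + of_bool (k = j))
          + of_bool (k = Suc (i - 1)) + of_bool (k = Suc (j - 1))))"
        by (rule weight_short_raise[OF step ij(1,2,5)]) (use False ij j in auto)
      then show ?thesis unfolding ij by simp
    qed
  qed
qed

lemma is_weight_bounds:
  assumes irr: irreducible_rep and hw: "has_highest_weight (\<lambda>i \<in> {1..n}. of_nat M)"
    and w: "is_weight w"
  obtains m :: "nat \<Rightarrow> int" where "\<And>k. k \<in> {1..n} \<Longrightarrow> w k = of_int (m k)"
    "\<And>k. k \<in> {1..n} \<Longrightarrow> \<bar>m k\<bar> \<le> int M" "even (\<Sum>k = 1..n. int M - m k)"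
proof -
  obtain c :: "nat \<Rightarrow> nat" where c: "\<And>k. k \<in> {1..n} \<Longrightarrow> w k = of_nat M - of_nat (c k)" "even (\<Sum>k = 1..n. c k)"
    using weight_upper_bound[OF irr hw w] by blast
  define m where "m k = int M - int (c k)" for k
  have wm: "w k = of_int (m k)" if "k \<in> {1..n}" for k using c(1)[OF that] by (simp add: m_def)
  have W: "is_weight (\<lambda>k. of_int (m k))" using w is_weight_cong[of w "\<lambda>k. of_int (m k)"] wm by blast
  have "- int M \<le> m k" if k: "k \<in> {1..n}" for k
  proof (rule ccontr)
    assume "\<not> - int M \<le> m k"
    have k': "k - 1 < n" "Suc (k - 1) = k" using k by auto
    \<comment> \<open>The number of steps that reflects coordinate \<open>k\<close>: it becomes
      \<open>- m k\<close>, which would exceed \<open>M\<close> and violate the upper bound.\<close>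
    define j where "j = nat (- m k)"
    have j: "int j = - m k" using \<open>\<not> - int M \<le> m k\<close> by (simp add: j_def)
    have "is_weight (\<lambda>l. of_int (m l + 2 * int j * of_bool (l = Suc (k - 1))))"
      by (rule weight_long_raise[OF W]) (use k' j in auto)
    then obtain c' :: "nat \<Rightarrow> nat" where "of_int (m k + 2 * int j * of_bool (k = Suc (k - 1))) = (of_nat M - of_nat (c' k) :: complex)"
      using weight_upper_bound[OF irr hw] k by metis
    then have "of_int (- m k) = (of_int (int M - int (c' k)) :: complex)"
      unfolding k'(2) j by simp
    then have "- m k = int M - int (c' k)" by (simp only: of_int_eq_iff)
    then show False using \<open>\<not> - int M \<le> m k\<close> by linarith
  qed
  then have "\<bar>m k\<bar> \<le> int M" if "k \<in> {1..n}" for k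
    using that by (fastforce simp: m_def abs_le_iff simp del: One_nat_def)
  moreover have "(\<Sum>k = 1..n. int M - m k) = int (\<Sum>k = 1..n. c k)" by (simp add: m_def)
  then have "even (\<Sum>k = 1..n. int M - m k)" using c(2) by (simp only: even_of_nat)
  ultimately show ?thesis using that wm by blast
qed

end

subsection \<open>Weights and labels\<close>

text \<open>The weight set written without reference to a representation. From here on only this set
  is compared with the lattice.\<close>

definition parity_box :: "nat \<Rightarrow> nat \<Rightarrow> (nat \<Rightarrow> complex) set" where
  "parity_box n M = {w \<in> extensional {1..n}. \<exists>m :: nat \<Rightarrow> int.
     (\<forall>k \<in> {1..n}. w k = of_int (m k) \<and> \<bar>m k\<bar> \<le> int M) \<and> even (\<Sum>k = 1..n. int M - m k)}"

lemma (in sp_representation) weights_eq_parity_box: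
  assumes irr: irreducible_rep and hw: "has_highest_weight (\<lambda>i \<in> {1..n}. of_nat M)"
  shows "weights = parity_box n M"
proof (intro equalityI subsetI)
  fix w assume "w \<in> weights"
  then have w: "w \<in> extensional {1..n}" "is_weight w" by (auto simp: weights_iff)
  obtain m :: "nat \<Rightarrow> int" where "\<And>k. k \<in> {1..n} \<Longrightarrow> w k = of_int (m k)"
    "\<And>k. k \<in> {1..n} \<Longrightarrow> \<bar>m k\<bar> \<le> int M" "even (\<Sum>k = 1..n. int M - m k)"
    by (rule is_weight_bounds[OF irr hw w(2)]) blast
  then show "w \<in> parity_box n M"
    unfolding parity_box_def using w(1) by (intro CollectI conjI exI[of _ m] ballI)
next
  fix w assume "w \<in> parity_box n M"
  then obtain m where w: "w \<in> extensional {1..n}" "\<And>k. k \<in> {1..n} \<Longrightarrow> w k = of_int (m k) \<and> \<bar>m k\<bar> \<le> int M"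
    "even (\<Sum>k = 1..n. int M - m k)"
    unfolding parity_box_def by blast
  have "is_weight (\<lambda>k. of_int (m k))"
    by (rule is_weight_if_bounded[OF hw _ w(3)]) (use w(2) in blast)
  moreover have "is_weight w \<longleftrightarrow> is_weight (\<lambda>k. of_int (m k))"
    by (rule is_weight_cong) (use w(2) in blast)
  ultimately show "w \<in> weights" using w(1) by (simp add: weights_iff)
qed

section \<open>Lattice nodes and the parity of their labels\<close>

lemma lattice_nodesE:
  assumes "l \<in> lattice_nodes n \<mu>"
  obtains d :: "nat \<Rightarrow> nat" where "\<And>k. k \<in> {1..n} \<Longrightarrow> l k = of_nat (d k)" "\<And>k. k \<in> {1..n} \<Longrightarrow> d k < \<mu>"
proof -
  have "\<exists>d. l k = of_nat d \<and> d < \<mu>" if "k \<in> {1..n}" for k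
  proof -
    have "l k \<in> of_int ` {0..<int \<mu>}"
      using assms that unfolding lattice_nodes_def by (rule PiE_mem)
    then obtain z where "z \<in> {0..<int \<mu>}" "l k = of_int z" by blast
    then show ?thesis by (intro exI[of _ "nat z"]) auto
  qed
  then show ?thesis using that by metis
qed

lemma lattice_nodesI:
  assumes "l \<in> extensional {1..n}" "\<And>k. k \<in> {1..n} \<Longrightarrow> l k = of_nat (d k)" "\<And>k. k \<in> {1..n} \<Longrightarrow> d k < \<mu>"
  shows "l \<in> lattice_nodes n \<mu>"
  unfolding lattice_nodes_def
proof (rule PiE_I)
  fix k assume "k \<in> {1..n}"
  then show "l k \<in> of_int ` {0..<int \<mu>}"
    using assms by (intro image_eqI[of _ _ "int (d k)"]) auto
next
  fix k assume "k \<notin> {1..n}"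
  then show "l k = undefined" using assms(1) by (simp add: extensional_def)
qed

lemma label_of_nat:
  assumes "\<And>k. k \<in> {1..n} \<Longrightarrow> l k = of_nat (d k)"
  shows "label n \<mu> l = of_nat (\<Sum>k = 1..n. d k * \<mu> ^ (k - 1))"
  using assms by (simp add: label_def)

lemma even_integer_of_nat: "even_integer (of_nat N) \<longleftrightarrow> even N"
proof
  assume "even_integer (of_nat N)"
  then obtain k :: int where "even k" "(of_nat N :: complex) = of_int k" by (auto simp: even_integer_def)
  moreover from this(2) have "int N = k" by (metis of_int_eq_iff of_int_of_nat_eq)
  ultimately show "even N" by auto
next
  assume "even N"
  then show "even_integer (of_nat N)"
    unfolding even_integer_def by (intro exI[of _ "int N"]) auto
qed

lemma even_label_iff:
  assumes "\<And>k. k \<in> {1..n} \<Longrightarrow> l k = of_nat (d k)" "odd \<mu>"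
  shows "even_integer (label n \<mu> l) \<longleftrightarrow> even (\<Sum>k = 1..n. d k)"
proof -
  have "even_integer (label n \<mu> l) \<longleftrightarrow> even (\<Sum>k = 1..n. d k * \<mu> ^ (k - 1))"
    by (simp only: label_of_nat[of n l d, OF assms(1)] even_integer_of_nat)
  then show ?thesis using assms(2) by (simp add: even_sum_iff)
qed

definition even_nodes :: "nat \<Rightarrow> nat \<Rightarrow> (nat \<Rightarrow> complex) set" where
  "even_nodes n \<mu> = {l \<in> lattice_nodes n \<mu>. even_integer (label n \<mu> l)}"

definition weight_of_node :: "nat \<Rightarrow> nat \<Rightarrow> (nat \<Rightarrow> complex) \<Rightarrow> nat \<Rightarrow> complex" where
  "weight_of_node n M l = (\<lambda>i \<in> {1..n}. l i - of_nat M)"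

lemma node_of_weight_even_nodes:
  assumes "w \<in> parity_box n M"
  shows "node_of_weight n M w \<in> even_nodes n (2 * M + 1)"
proof -
  obtain m where m: "\<And>k. k \<in> {1..n} \<Longrightarrow> w k = of_int (m k)" "\<And>k. k \<in> {1..n} \<Longrightarrow> \<bar>m k\<bar> \<le> int M"
    "even (\<Sum>k = 1..n. int M - m k)"
    using assms unfolding parity_box_def by blast
  define d where "d k = nat (m k + int M)" for k
  have d: "int (d k) = m k + int M" "d k < 2 * M + 1" if "k \<in> {1..n}" for k
    using m(2)[OF that] by (auto simp: d_def)
  have node: "node_of_weight n M w k = of_nat (d k)" if k: "k \<in> {1..n}" for k
  proof -
    have "(of_nat (d k) :: complex) = of_int (int (d k))" by simp
    then show ?thesis using k m(1)[OF k] unfolding d(1)[OF k] by (simp add: node_of_weight_def)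
  qed
  \<comment> \<open>Each digit is \<open>2 * M\<close> minus the deficit \<open>M - m k\<close>, so
    the digit sum and the sum of deficits have the same parity.\<close>
  have "int (\<Sum>k = 1..n. d k) = (\<Sum>k = 1..n. 2 * int M - (int M - m k))"
    unfolding of_nat_sum by (intro sum.cong) (simp_all add: d)
  also have "\<dots> = 2 * (int n * int M) - (\<Sum>k = 1..n. int M - m k)"
    by (simp only: sum_subtractf) simp
  finally have "even (int (\<Sum>k = 1..n. d k))" using m(3) by (simp only: even_diff) simp
  then have "even (\<Sum>k = 1..n. d k)" by (simp only: even_of_nat)
  then show ?thesis
    unfolding even_nodes_def
    using lattice_nodesI[of "node_of_weight n M w" n d, OF _ node d(2)]
      even_label_iff[of n "node_of_weight n M w" d "2 * M + 1", OF node]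
    by (simp add: node_of_weight_def)
qed

lemma weight_of_node_parity_box:
  assumes "l \<in> even_nodes n (2 * M + 1)"
  shows "weight_of_node n M l \<in> parity_box n M"
proof -
  obtain d where d: "\<And>k. k \<in> {1..n} \<Longrightarrow> l k = of_nat (d k)" "\<And>k. k \<in> {1..n} \<Longrightarrow> d k < 2 * M + 1"
    using assms lattice_nodesE[of l n "2 * M + 1"] unfolding even_nodes_def by blast
  have "even (\<Sum>k = 1..n. d k)"
    using assms even_label_iff[of n l d "2 * M + 1", OF d(1)] by (simp add: even_nodes_def)
  then have ev: "even (int (\<Sum>k = 1..n. d k))" by (simp only: even_of_nat)
  have "(\<Sum>k = 1..n. int M - (int (d k) - int M)) = (\<Sum>k = 1..n. 2 * int M - int (d k))"
    by (intro sum.cong) simp_all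
  also have "\<dots> = 2 * (int n * int M) - int (\<Sum>k = 1..n. d k)"
    by (simp only: sum_subtractf) simp
  finally have even: "even (\<Sum>k = 1..n. int M - (int (d k) - int M))"
    using ev by (simp only: even_diff) simp
  have "weight_of_node n M l k = of_int (int (d k) - int M) \<and> \<bar>int (d k) - int M\<bar> \<le> int M"
    if "k \<in> {1..n}" for k
    using that d(1)[OF that] d(2)[OF that] by (auto simp: weight_of_node_def)
  then show ?thesis
    unfolding parity_box_def using even
    by (intro CollectI conjI exI[of _ "\<lambda>k. int (d k) - int M"] ballI) (auto simp: weight_of_node_def)
qed

lemma weight_of_node_inverse:
  assumes "l \<in> lattice_nodes n \<mu>"
  shows "node_of_weight n M (weight_of_node n M l) = l"
proof
  fix k show "node_of_weight n M (weight_of_node n M l) k = l k"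
    using assms by (auto simp: node_of_weight_def weight_of_node_def lattice_nodes_def PiE_def extensional_def)
qed

lemma node_of_weight_inverse:
  assumes "w \<in> extensional {1..n}"
  shows "weight_of_node n M (node_of_weight n M w) = w"
proof
  fix k show "weight_of_node n M (node_of_weight n M w) k = w k"
    using assms by (auto simp: node_of_weight_def weight_of_node_def extensional_def)
qed

lemma bij_betw_node_of_weight:
  "bij_betw (node_of_weight n M) (parity_box n M) (even_nodes n (2 * M + 1))"
  "bij_betw (weight_of_node n M) (even_nodes n (2 * M + 1)) (parity_box n M)"
proof -
  have 1: "\<forall>w\<in>parity_box n M. weight_of_node n M (node_of_weight n M w) = w"
    using node_of_weight_inverse unfolding parity_box_def by blast
  have 2: "\<forall>l\<in>even_nodes n (2 * M + 1). node_of_weight n M (weight_of_node n M l) = l"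
    using weight_of_node_inverse unfolding even_nodes_def by blast
  have 3: "node_of_weight n M ` parity_box n M \<subseteq> even_nodes n (2 * M + 1)"
    "weight_of_node n M ` even_nodes n (2 * M + 1) \<subseteq> parity_box n M"
    using node_of_weight_even_nodes weight_of_node_parity_box by blast+
  show "bij_betw (node_of_weight n M) (parity_box n M) (even_nodes n (2 * M + 1))"
    using 1 2 3 by (rule bij_betw_byWitness)
  show "bij_betw (weight_of_node n M) (even_nodes n (2 * M + 1)) (parity_box n M)"
    using 2 1 3(2,1) by (rule bij_betw_byWitness)
qed

section \<open>Base-\<mu> digits and the enumeration of even labels\<close>

lemma double_less_odd_iff:
  assumes "odd (N :: nat)"
  shows "2 * p < N \<longleftrightarrow> p \<in> {0..(N - 1) div 2}"
proof -
  obtain b where "N = 2 * b + 1" using assms by (rule oddE)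
  then show ?thesis by auto
qed

text \<open>The base-\<mu> expansion of \<open>p\<close>, least significant digit in coordinate 1;
  \<open>label\<close> inverts it for \<open>p < \<mu> ^ n\<close>.\<close>

definition digit_node :: "nat \<Rightarrow> nat \<Rightarrow> nat \<Rightarrow> nat \<Rightarrow> complex" where
  "digit_node n \<mu> p = (\<lambda>k \<in> {1..n}. of_nat (p div \<mu> ^ (k - 1) mod \<mu>))"

lemma sum_digits: "(\<Sum>k = 1..n. (p div \<mu> ^ (k - 1) mod \<mu>) * \<mu> ^ (k - 1)) = p mod \<mu> ^ n" for p \<mu> :: nat
proof (induction n)
  case (Suc n)
  have "p mod (\<mu> ^ n * \<mu>) = \<mu> ^ n * (p div \<mu> ^ n mod \<mu>) + p mod \<mu> ^ n"
    by (rule mod_mult2_eq)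
  then show ?case using Suc.IH by (simp add: mult_ac)
qed simp

lemma label_digit_node: "p < \<mu> ^ n \<Longrightarrow> label n \<mu> (digit_node n \<mu> p) = of_nat p"
  using label_of_nat[of n "digit_node n \<mu> p" "\<lambda>k. p div \<mu> ^ (k - 1) mod \<mu>" \<mu>]
  by (simp only: sum_digits) (simp add: digit_node_def)

text \<open>Surjectivity by counting: the label recovers \<open>p\<close>, so the digit map is
  injective on \<open>\<mu> ^ n\<close> numbers, and the lattice has just as many nodes.\<close>

lemma lattice_nodes_eq_digit_nodes:
  assumes "\<mu> > 0"
  shows "lattice_nodes n \<mu> = digit_node n \<mu> ` {..<\<mu> ^ n}"
proof (rule card_subset_eq[symmetric])
  show "finite (lattice_nodes n \<mu>)" by (simp add: lattice_nodes_def finite_PiE)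
  show "digit_node n \<mu> ` {..<\<mu> ^ n} \<subseteq> lattice_nodes n \<mu>"
  proof clarify
    fix p show "digit_node n \<mu> p \<in> lattice_nodes n \<mu>"
      by (rule lattice_nodesI[where d = "\<lambda>k. p div \<mu> ^ (k - 1) mod \<mu>"])
        (use assms in \<open>auto simp: digit_node_def\<close>)
  qed
  have "inj_on (digit_node n \<mu>) {..<\<mu> ^ n}"
    by (rule inj_onI) (metis label_digit_node lessThan_iff of_nat_eq_iff)
  then have "card (digit_node n \<mu> ` {..<\<mu> ^ n}) = \<mu> ^ n" by (simp add: card_image)
  also have "\<dots> = card (lattice_nodes n \<mu>)"
    by (simp add: lattice_nodes_def card_PiE card_image inj_on_def)
  finally show "card (digit_node n \<mu> ` {..<\<mu> ^ n}) = card (lattice_nodes n \<mu>)" .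
qed

lemma bij_betw_digit_node:
  assumes "odd \<mu>"
  shows "bij_betw (\<lambda>p. digit_node n \<mu> (2 * p)) {0..(\<mu> ^ n - 1) div 2} (even_nodes n \<mu>)"
proof -
  have pos: "\<mu> > 0" using assms by (auto intro: Nat.gr0I)
  have less: "2 * p < \<mu> ^ n \<longleftrightarrow> p \<in> {0..(\<mu> ^ n - 1) div 2}" for p
    using assms by (intro double_less_odd_iff) simp
  have "inj_on (\<lambda>p. digit_node n \<mu> (2 * p)) {0..(\<mu> ^ n - 1) div 2}"
  proof (rule inj_onI)
    fix p q assume "p \<in> {0..(\<mu> ^ n - 1) div 2}" "q \<in> {0..(\<mu> ^ n - 1) div 2}"
      "digit_node n \<mu> (2 * p) = digit_node n \<mu> (2 * q)"
    then have "(of_nat (2 * p) :: complex) = of_nat (2 * q)"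
      using label_digit_node less by metis
    then have "2 * p = 2 * q" by (simp only: of_nat_eq_iff)
    then show "p = q" by simp
  qed
  moreover have "(\<lambda>p. digit_node n \<mu> (2 * p)) ` {0..(\<mu> ^ n - 1) div 2} = even_nodes n \<mu>"
  proof (intro equalityI subsetI)
    fix l assume "l \<in> (\<lambda>p. digit_node n \<mu> (2 * p)) ` {0..(\<mu> ^ n - 1) div 2}"
    then obtain p where "l = digit_node n \<mu> (2 * p)" "2 * p < \<mu> ^ n" using less by blast
    then show "l \<in> even_nodes n \<mu>"
      unfolding even_nodes_def
      using lattice_nodes_eq_digit_nodes[OF pos] even_integer_of_nat[of "2 * p"]
      by (auto simp: label_digit_node simp del: of_nat_mult)
  next
    fix l assume l: "l \<in> even_nodes n \<mu>"
    then obtain q where q: "l = digit_node n \<mu> q" "q < \<mu> ^ n"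
      using lattice_nodes_eq_digit_nodes[OF pos] unfolding even_nodes_def by blast
    then have "even q" using l by (simp add: even_nodes_def label_digit_node even_integer_of_nat)
    then obtain p where "q = 2 * p" by blast
    then show "l \<in> (\<lambda>p. digit_node n \<mu> (2 * p)) ` {0..(\<mu> ^ n - 1) div 2}" using q less by blast
  qed
  ultimately show ?thesis by (simp add: bij_betw_def)
qed

theorem theorem1:
  fixes M n \<mu> :: nat
    and scale :: "complex \<Rightarrow> 'v::ab_group_add \<Rightarrow> 'v"
    and Basis :: "'v set"
    and \<rho> :: "complex mat \<Rightarrow> 'v \<Rightarrow> 'v"
  assumes "M \<ge> 1" and "n \<ge> 1" and "\<mu> = 2 * M + 1"
    and "sp_representation scale Basis n \<rho>"
    and "sp_representation.irreducible_rep scale n \<rho>"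
    and "sp_representation.has_highest_weight scale n \<rho> (\<lambda>i \<in> {1..n}. of_nat M)"
  shows "(\<forall>w \<in> sp_representation.weights scale n \<rho>.
           (\<forall>i \<in> {1..n}. w i \<in> of_int ` {- int M..int M}) \<and>
           node_of_weight n M w \<in> lattice_nodes n \<mu> \<and>
           even_integer (label n \<mu> (node_of_weight n M w))) \<and>
         bij_betw (node_of_weight n M) (sp_representation.weights scale n \<rho>)
           {l \<in> lattice_nodes n \<mu>. even_integer (label n \<mu> l)} \<and>
         (\<exists>w\<^sub>p :: nat \<Rightarrow> nat \<Rightarrow> complex.
           bij_betw w\<^sub>p {0..(\<mu> ^ n - 1) div 2} (sp_representation.weights scale n \<rho>) \<and>
           (\<forall>p \<in> {0..(\<mu> ^ n - 1) div 2}.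
              node_of_weight n M (w\<^sub>p p) \<in> lattice_nodes n \<mu> \<and>
              label n \<mu> (node_of_weight n M (w\<^sub>p p)) = of_nat (2 * p)))"
proof -
  interpret sp_representation scale Basis n \<rho> by (rule assms(4))
  have W: "weights = parity_box n M" by (rule weights_eq_parity_box[OF assms(5,6)])
  have odd: "odd \<mu>" using assms(3) by simp
  have bij: "bij_betw (node_of_weight n M) weights (even_nodes n \<mu>)"
    "bij_betw (weight_of_node n M) (even_nodes n \<mu>) weights"
    unfolding W assms(3) by (rule bij_betw_node_of_weight)+
  \<comment> \<open>The weight belonging to the node whose digits are those of \<open>2 * p\<close>,
    so that its label is known from the start.\<close>
  define w\<^sub>p where "w\<^sub>p = weight_of_node n M \<circ> (\<lambda>p. digit_node n \<mu> (2 * p))"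
  have wp: "bij_betw w\<^sub>p {0..(\<mu> ^ n - 1) div 2} weights"
    unfolding w\<^sub>p_def by (rule bij_betw_trans[OF bij_betw_digit_node[OF odd] bij(2)])
  have "node_of_weight n M (w\<^sub>p p) \<in> lattice_nodes n \<mu> \<and>
      label n \<mu> (node_of_weight n M (w\<^sub>p p)) = of_nat (2 * p)" if p: "p \<in> {0..(\<mu> ^ n - 1) div 2}" for p
  proof -
    have "digit_node n \<mu> (2 * p) \<in> lattice_nodes n \<mu>"
      using bij_betwE[OF bij_betw_digit_node[OF odd]] p by (auto simp: even_nodes_def)
    moreover have "2 * p < \<mu> ^ n"
      using double_less_odd_iff[of "\<mu> ^ n" p] odd p by simp
    ultimately show ?thesis
      by (simp add: w\<^sub>p_def weight_of_node_inverse label_digit_node del: of_nat_mult)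
  qed
  moreover have "w i \<in> of_int ` {- int M..int M}" if "w \<in> weights" "i \<in> {1..n}" for w i
  proof -
    obtain m where "w i = of_int m" "\<bar>m\<bar> \<le> int M"
      using \<open>w \<in> weights\<close> \<open>i \<in> {1..n}\<close> unfolding W parity_box_def by blast
    then show ?thesis by (intro image_eqI[of _ _ m]) auto
  qed
  moreover have "node_of_weight n M w \<in> even_nodes n \<mu>" if "w \<in> weights" for w
    using bij_betwE[OF bij(1)] that by blast
  ultimately show ?thesis
    using bij(1) wp unfolding even_nodes_def by blast
qed

end
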